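(* Let $\mathcal{U},\mathcal{V}$ be Hilbert spaces over $\mathbb{F}\in\{\mathbb{R},\mathbb{C}\}$, let $\mathcal{B}:\mathcal{U}\to\mathcal{V}'$ be a bounded linear operator, let $\ell\in\mathcal{V}'$, and let $\mathcal{U}_h\subset\mathcal{U}$ and $\mathcal{V}_r\subset\mathcal{V}$ be finite-dimensional linear subspaces, with $\mathcal{B}$ injective on $\mathcal{U}_h$. Let $\mathcal{R}_{\mathcal{V}}:\mathcal{V}\to\mathcal{V}'$ be the Riesz map of $\mathcal{V}$, and let $\mathcal{R}_{\mathcal{V}_r}^{-1}:\mathcal{V}'\to\mathcal{V}_r\subset\mathcal{V}$ be the extended inverse discrete Riesz map defined in the context. Suppose that $$\mathcal{B}(\mathcal{U}_h)\subset\mathcal{R}_{\mathcal{V}}\mathcal{V}_r .$$ (i) The minimizers $$\mathfrak{u}_h^{\mathrm{opt}}=\operatorname*{arg\,min}_{\mathfrak{u}_h\in\mathcal{U}_h}\|\mathcal{B}\mathfrak{u}_h-\ell\|_{\mathcal{V}'}^2,\qquad \mathfrak{u}_{h,r}^{\mathrm{opt}}=\operatorname*{arg\,min}_{\mathfrak{u}_h\in\mathcal{U}_h}\big\|\mathcal{R}_{\mathcal{V}_r}^{-1}(\mathcal{B}\mathfrak{u}_h-\ell)\big\|_{\mathcal{V}}^2$$ coincide: $\mathfrak{u}_h^{\mathrm{opt}}=\mathfrak{u}_{h,r}^{\mathrm{opt}}$. (ii) Suppose moreover that $\mathcal{V}=L^2(\Omega)$ and $\mathcal{B}=\mathcal{R}_{L^2(\Omega)}\mathcal{L}$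 for a bounded linear operator $\mathcal{L}:\mathcal{U}\to L^2(\Omega)$. Let $\{\mathfrak{u}_i\}_{i=1}^N$ be a basis of $\mathcal{U}_h$ and $\{\mathfrak{v}_i\}_{i=1}^M$ a basis of $\mathcal{V}_r$. Then the least-squares stiffness matrix $$(\mathsf{A}_{\mathrm{LS}})_{ij}=(\mathcal{L}\mathfrak{u}_j,\mathcal{L}\mathfrak{u}_i)_{L^2(\Omega)},\qquad 1\le i,j\le N,$$ equals the stiffness matrix $\mathsf{A}=\mathsf{B}^*\mathsf{G}^{-1}\mathsf{B}$ of the normal equation of the discrete least-squares method, where $\mathsf{B}\in\mathbb{F}^{M\times N}$, $\mathsf{B}_{ij}=\langle\mathcal{B}\mathfrak{u}_j,\mathfrak{v}_i\rangle$, and $\mathsf{G}\in\mathbb{F}^{M\times M}$, $\mathsf{G}_{ij}=(\mathfrak{v}_j,\mathfrak{v}_i)_{\mathcal{V}}$.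
   Context: $\Omega\subset\mathbb{R}^d$ is a bounded Lipschitz domain. For a Hilbert space $\mathcal{V}$ over $\mathbb{F}$, the inner product $(\cdot,\cdot)_{\mathcal{V}}$ is linear in its first argument and antilinear in its second; $\mathcal{V}'$ is the space of bounded antilinear functionals on $\mathcal{V}$ (for $\mathbb{F}=\mathbb{R}$, the usual dual), with dual norm $\|\cdot\|_{\mathcal{V}'}$ and duality pairing $\langle\cdot,\cdot\rangle$. The Riesz map $\mathcal{R}_{\mathcal{V}}:\mathcal{V}\to\mathcal{V}'$ is the isometric isomorphism given by $\langle\mathcal{R}_{\mathcal{V}}\mathfrak{v},\delta\mathfrak{v}\rangle=(\mathfrak{v},\delta\mathfrak{v})_{\mathcal{V}}$ for all $\mathfrak{v},\delta\mathfrak{v}\in\mathcal{V}$. For a finite-dimensional subspace $\mathcal{V}_r\subset\mathcal{V}$ (with the inner product of $\mathcal{V}$), the discrete Riesz map $\mathcal{R}_{\mathcal{V}_r}:\mathcal{V}_r\to\mathcal{V}_r'$ is given by $\langle\mathcal{R}_{\mathcal{V}_r}\mathfrak{v},\delta\mathfrak{v}\rangle=(\mathfrak{v},\delta\mathfrak{v})_{\mathcal{V}}$ for all $\mathfrak{v},\delta\mathfrak{v}\in\mathcal{V}_r$. By abuse of notation, $\mathcal{R}_{\mathcal{V}_r}^{-1}:\mathcal{V}'\to\mathcal{V}_r\subset\mathcal{V}$ also denotes $\mathcal{R}_{\mathcal{V}_r}^{-1}\circ\iota_r'$, where $\iota_r':\mathcal{V}'\to\mathcal{V}_r'$ is the restriction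 of functionals to $\mathcal{V}_r$ (the dual of the canonical embedding $\iota_r:\mathcal{V}_r\to\mathcal{V}$). $\mathcal{R}_{\mathcal{V}}\mathcal{V}_r$ denotes the image of $\mathcal{V}_r$ under $\mathcal{R}_{\mathcal{V}}$, and $\mathsf{B}^*$ denotes the conjugate transpose of $\mathsf{B}$. *)

theory Defs
  imports
    "HOL-Analysis.Analysis"
    "Jordan_Normal_Form.Schur_Decomposition"
    "Jordan_Normal_Form.Gauss_Jordan_Elimination"
begin

section \<open>Hilbert spaces over the reals or the complex numbers\<close>

text \<open>
  The scalar field is a set \<open>F\<close> of complex numbers, either \<open>\<real>\<close> or \<open>UNIV\<close>. Spaces are
  carrier-based modules over it, so that \<open>L\<^sup>2(\<Omega>)\<close> for a given \<open>\<Omega>\<close> is such a space and a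
  subspace \<open>W\<close> with the inherited inner product is \<open>V\<lparr>carrier := W\<rparr>\<close>. The fields
  \<open>mult\<close> and \<open>one\<close>, which modules inherit from rings, play no role.
\<close>

definition scalars :: "complex set \<Rightarrow> complex ring" where
  "scalars F = \<lparr>carrier = F, mult = (*), one = 1, zero = 0, add = (+)\<rparr>"

record 'v ip_space = "(complex, 'v) module" +
  iprod :: "'v \<Rightarrow> 'v \<Rightarrow> complex"

definition ip_norm :: "('v, 'x) ip_space_scheme \<Rightarrow> 'v \<Rightarrow> real" where
  "ip_norm V x = sqrt (Re (iprod V x x))"

definition hilbert_space :: "complex set \<Rightarrow> 'v ip_space \<Rightarrow> bool" where
  "hilbert_space F V \<longleftrightarrow>
     vectorspace (scalars F) V \<and>
     (\<forall>x\<in>carrier V. \<forall>y\<in>carrier V. iprod V x y \<in> F) \<and>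
     (\<forall>x\<in>carrier V. \<forall>y\<in>carrier V. \<forall>z\<in>carrier V.
        iprod V (x \<oplus>\<^bsub>V\<^esub> y) z = iprod V x z + iprod V y z) \<and>
     (\<forall>c\<in>F. \<forall>x\<in>carrier V. \<forall>y\<in>carrier V. iprod V (c \<odot>\<^bsub>V\<^esub> x) y = c * iprod V x y) \<and>
     (\<forall>x\<in>carrier V. \<forall>y\<in>carrier V. iprod V y x = cnj (iprod V x y)) \<and>
     (\<forall>x\<in>carrier V. x \<noteq> \<zero>\<^bsub>V\<^esub> \<longrightarrow> Re (iprod V x x) > 0) \<and>
     (\<forall>X :: nat \<Rightarrow> 'v. range X \<subseteq> carrier V \<longrightarrow>
        (\<forall>e>0. \<exists>n0. \<forall>m\<ge>n0. \<forall>n\<ge>n0. ip_norm V (X m \<ominus>\<^bsub>V\<^esub> X n) < e) \<longrightarrow>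
        (\<exists>x\<in>carrier V. (\<lambda>n. ip_norm V (X n \<ominus>\<^bsub>V\<^esub> x)) \<longlonglongrightarrow> 0))"

definition fin_dim_subspace :: "complex set \<Rightarrow> 'v set \<Rightarrow> 'v ip_space \<Rightarrow> bool" where
  "fin_dim_subspace F W V \<longleftrightarrow>
     subspace (scalars F) W V \<and> vectorspace.fin_dim (scalars F) (V\<lparr>carrier := W\<rparr>)"

definition is_basis :: "complex set \<Rightarrow> 'v set \<Rightarrow> 'v ip_space \<Rightarrow> 'v list \<Rightarrow> bool" where
  "is_basis F W V bs \<longleftrightarrow>
     distinct bs \<and> vectorspace.basis (scalars F) (V\<lparr>carrier := W\<rparr>) (set bs)"


section \<open>Antidual space and Riesz maps\<close>

text \<open>
  Functionals are normalised to be \<open>undefined\<close> outside the carrier, so that equality of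
  functionals is equality on the space. The set in \<open>dual_norm\<close> contains \<open>0\<close>, so the norm
  also makes sense on the trivial space.
\<close>

definition dual_norm :: "('v, 'x) ip_space_scheme \<Rightarrow> ('v \<Rightarrow> complex) \<Rightarrow> real" where
  "dual_norm V f = (SUP v \<in> {v \<in> carrier V. ip_norm V v \<le> 1}. cmod (f v))"

definition dual_space :: "complex set \<Rightarrow> 'v ip_space \<Rightarrow> (complex, 'v \<Rightarrow> complex) module" where
  "dual_space F V =
     \<lparr>carrier = {f \<in> carrier V \<rightarrow>\<^sub>E F.
        (\<forall>x\<in>carrier V. \<forall>y\<in>carrier V. f (x \<oplus>\<^bsub>V\<^esub> y) = f x + f y) \<and>
        (\<forall>c\<in>F. \<forall>x\<in>carrier V. f (c \<odot>\<^bsub>V\<^esub> x) = cnj c * f x) \<and>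
        (\<exists>C. \<forall>x\<in>carrier V. cmod (f x) \<le> C * ip_norm V x)},
      mult = undefined, one = undefined,
      zero = (\<lambda>v\<in>carrier V. 0),
      add = (\<lambda>f g. \<lambda>v\<in>carrier V. f v + g v),
      smult = (\<lambda>c f. \<lambda>v\<in>carrier V. c * f v)\<rparr>"

definition riesz :: "'v ip_space \<Rightarrow> 'v \<Rightarrow> 'v \<Rightarrow> complex" where
  "riesz V v = (\<lambda>w\<in>carrier V. iprod V v w)"

text \<open>
  The inverse of the Riesz map of \<open>W\<close>, precomposed with the restriction of functionals
  from \<open>V\<close> to \<open>W\<close>.
\<close>

definition discrete_riesz_inv :: "'v ip_space \<Rightarrow> 'v set \<Rightarrow> ('v \<Rightarrow> complex) \<Rightarrow> 'v" where
  "discrete_riesz_inv V W f = inv_into W (riesz (V\<lparr>carrier := W\<rparr>)) (restrict f W)"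

definition bounded_linear_op ::
  "complex set \<Rightarrow> 'u ip_space \<Rightarrow> (complex, 'w, 'x) module_scheme \<Rightarrow> ('w \<Rightarrow> real) \<Rightarrow> ('u \<Rightarrow> 'w) \<Rightarrow> bool"
  where
  "bounded_linear_op F U W nrm T \<longleftrightarrow>
     T \<in> module_hom (scalars F) U W \<and>
     (\<exists>C. \<forall>u\<in>carrier U. nrm (T u) \<le> C * ip_norm U u)"

definition discrete_ls_setting ::
  "complex set \<Rightarrow> 'u ip_space \<Rightarrow> 'v ip_space \<Rightarrow> ('u \<Rightarrow> 'v \<Rightarrow> complex) \<Rightarrow> 'u set \<Rightarrow> 'v set \<Rightarrow> bool" where
  "discrete_ls_setting F U V B Uh Vr \<longleftrightarrow>
     F \<in> {\<real>, UNIV} \<and>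
     hilbert_space F U \<and> hilbert_space F V \<and>
     bounded_linear_op F U (dual_space F V) (dual_norm V) B \<and>
     fin_dim_subspace F Uh U \<and> fin_dim_subspace F Vr V \<and>
     inj_on B Uh \<and>
     B ` Uh \<subseteq> riesz V ` Vr"


section \<open>Lipschitz domains\<close>

text \<open>
  Near each boundary point the domain lies strictly above a Lipschitz graph in the direction
  of some unit vector \<open>e\<close>; \<open>x - (x \<bullet> e) e\<close> is the component of \<open>x\<close> in the hyperplane
  orthogonal to \<open>e\<close>.
\<close>

definition bounded_lipschitz_domain :: "(real ^ 'd) set \<Rightarrow> bool" where
  "bounded_lipschitz_domain \<Omega> \<longleftrightarrow>
     \<Omega> \<noteq> {} \<and> open \<Omega> \<and> connected \<Omega> \<and> bounded \<Omega> \<and>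
     (\<forall>p\<in>frontier \<Omega>. \<exists>r>0. \<exists>e \<gamma> C. norm e = 1 \<and>
        C-lipschitz_on {y. inner y e = 0} \<gamma> \<and>
        \<Omega> \<inter> ball p r = {x \<in> ball p r. inner x e > \<gamma> (x - inner x e *\<^sub>R e)})"


section \<open>The Lebesgue space of square-integrable functions\<close>

text \<open>
  The elements are classes of functions modulo equality almost everywhere. The operations
  use chosen representatives; they do not depend on the choice.
\<close>

definition L2_fun :: "complex set \<Rightarrow> 'a measure \<Rightarrow> ('a \<Rightarrow> complex) set" where
  "L2_fun F M = {f \<in> borel_measurable M. f ` space M \<subseteq> F \<and> integrable M (\<lambda>x. (cmod (f x))\<^sup>2)}"

definition L2_rel :: "complex set \<Rightarrow> 'a measure \<Rightarrow> (('a \<Rightarrow> complex) \<times> ('a \<Rightarrow> complex)) set" where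
  "L2_rel F M = {(f, g). f \<in> L2_fun F M \<and> g \<in> L2_fun F M \<and> (AE x in M. f x = g x)}"

definition L2_class :: "complex set \<Rightarrow> 'a measure \<Rightarrow> ('a \<Rightarrow> complex) \<Rightarrow> ('a \<Rightarrow> complex) set" where
  "L2_class F M f = L2_rel F M `` {f}"

definition L2_rep :: "('a \<Rightarrow> complex) set \<Rightarrow> 'a \<Rightarrow> complex" where
  "L2_rep A = (SOME f. f \<in> A)"

definition L2_space :: "complex set \<Rightarrow> 'a measure \<Rightarrow> ('a \<Rightarrow> complex) set ip_space" where
  "L2_space F M =
     \<lparr>carrier = L2_fun F M // L2_rel F M,
      mult = undefined, one = undefined,
      zero = L2_class F M (\<lambda>_. 0),
      add = (\<lambda>A B. L2_class F M (\<lambda>x. L2_rep A x + L2_rep B x)),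
      smult = (\<lambda>c A. L2_class F M (\<lambda>x. c * L2_rep A x)),
      iprod = (\<lambda>A B. LINT x|M. L2_rep A x * cnj (L2_rep B x))\<rparr>"

abbreviation L2_domain :: "complex set \<Rightarrow> (real ^ 'd) set \<Rightarrow> (real ^ 'd \<Rightarrow> complex) set ip_space" where
  "L2_domain F \<Omega> \<equiv> L2_space F (lebesgue_on \<Omega>)"


subsection \<open>The space of square-integrable functions is a Hilbert space\<close>

lemma field_scalars:
  assumes "F \<in> {\<real>, UNIV}"
  shows "field (scalars F)"
proof -
  have cl: "1 \<in> F" "0 \<in> F" "\<And>x y. x \<in> F \<Longrightarrow> y \<in> F \<Longrightarrow> x + y \<in> F"
    "\<And>x y. x \<in> F \<Longrightarrow> y \<in> F \<Longrightarrow> x * y \<in> F" "\<And>x. x \<in> F \<Longrightarrow> -x \<in> F" "\<And>x. x \<in> F \<Longrightarrow> inverse x \<in> F"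
    using assms by auto
  have "cring (scalars F)"
    by (intro cringI abelian_groupI comm_monoidI)
      (use cl in \<open>auto simp: scalars_def algebra_simps intro!: bexI[of _ "- _"]\<close>)
  then show ?thesis
  proof (rule cring.cring_fieldI2)
    fix a assume "a \<in> carrier (scalars F)" "a \<noteq> \<zero>\<^bsub>scalars F\<^esub>"
    then have "inverse a \<in> F" "a * inverse a = 1" using cl by (auto simp: scalars_def)
    then show "\<exists>b\<in>carrier (scalars F). a \<otimes>\<^bsub>scalars F\<^esub> b = \<one>\<^bsub>scalars F\<^esub>"
      by (auto simp: scalars_def)
  qed (simp add: scalars_def)
qed

lemma L2_fun_add:
  assumes F: "F \<in> {\<real>, UNIV}" and f: "f \<in> L2_fun F M" and g: "g \<in> L2_fun F M"
  shows "(\<lambda>x. f x + g x) \<in> L2_fun F M"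
proof -
  have [measurable]: "f \<in> borel_measurable M" "g \<in> borel_measurable M"
    using f g by (auto simp: L2_fun_def)
  have "integrable M (\<lambda>x. (cmod (f x + g x))\<^sup>2)"
  proof (rule Bochner_Integration.integrable_bound)
    show "integrable M (\<lambda>x. 2 * (cmod (f x))\<^sup>2 + 2 * (cmod (g x))\<^sup>2)"
      using f g by (auto simp: L2_fun_def)
    have "(cmod (f x + g x))\<^sup>2 \<le> 2 * (cmod (f x))\<^sup>2 + 2 * (cmod (g x))\<^sup>2" for x
    proof -
      have "(cmod (f x + g x))\<^sup>2 \<le> (cmod (f x) + cmod (g x))\<^sup>2"
        by (simp add: norm_triangle_ineq power_mono)
      also have "\<dots> \<le> 2 * (cmod (f x))\<^sup>2 + 2 * (cmod (g x))\<^sup>2"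
        using sum_squares_bound[of "cmod (f x)" "cmod (g x)"] by (simp add: power2_sum)
      finally show ?thesis .
    qed
    then show "AE x in M. norm ((cmod (f x + g x))\<^sup>2) \<le> norm (2 * (cmod (f x))\<^sup>2 + 2 * (cmod (g x))\<^sup>2)"
      by simp
  qed simp
  moreover have "(\<lambda>x. f x + g x) ` space M \<subseteq> F"
    using F f g by (auto simp: L2_fun_def image_subset_iff)
  ultimately show ?thesis by (simp add: L2_fun_def)
qed

lemma L2_fun_mult:
  assumes F: "F \<in> {\<real>, UNIV}" and c: "c \<in> F" and f: "f \<in> L2_fun F M"
  shows "(\<lambda>x. c * f x) \<in> L2_fun F M"
  using assms by (auto simp: L2_fun_def image_subset_iff norm_mult power_mult_distrib)

lemma L2_fun_zero: 
  assumes F: "F \<in> {\<real>, UNIV}"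
  shows "(\<lambda>x. 0) \<in> L2_fun F M"
  using assms by (auto simp: L2_fun_def)

lemma L2_fun_diff:
  assumes F: "F \<in> {\<real>, UNIV}" and f: "f \<in> L2_fun F M" and g: "g \<in> L2_fun F M"
  shows "(\<lambda>x. f x - g x) \<in> L2_fun F M"
  using L2_fun_add[OF F f L2_fun_mult[OF F _ g, of "-1"]] F by auto

lemma equiv_L2_rel: "equiv (L2_fun F M) (L2_rel F M)"
proof (rule equivI)
  show "L2_rel F M \<subseteq> L2_fun F M \<times> L2_fun F M" by (auto simp: L2_rel_def)
  show "refl_on (L2_fun F M) (L2_rel F M)" by (auto simp: refl_on_def L2_rel_def)
  show "sym (L2_rel F M)" by (auto simp: sym_def L2_rel_def)
  show "trans (L2_rel F M)" 
    by (auto simp: trans_def L2_rel_def)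
qed

lemma L2_class_carrier: "f \<in> L2_fun F M \<Longrightarrow> L2_class F M f \<in> carrier (L2_space F M)"
  by (simp add: L2_class_def L2_space_def quotientI)

lemma L2_class_eq_iff:
  assumes "f \<in> L2_fun F M" "g \<in> L2_fun F M"
  shows "L2_class F M f = L2_class F M g \<longleftrightarrow> (AE x in M. f x = g x)"
  using assms eq_equiv_class_iff[OF equiv_L2_rel, of f F M g]
  by (auto simp: L2_class_def L2_rel_def)

lemma L2_rep:
  assumes "A \<in> carrier (L2_space F M)"
  shows "L2_rep A \<in> L2_fun F M" and "L2_class F M (L2_rep A) = A"
proof -
  from assms obtain f where f: "f \<in> L2_fun F M" "A = L2_rel F M `` {f}"
    by (auto simp: L2_space_def elim!: quotientE)
  have "f \<in> A" using f equiv_class_self[OF equiv_L2_rel] by auto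
  then have r: "L2_rep A \<in> A" unfolding L2_rep_def by (rule someI[of "\<lambda>f. f \<in> A"])
  then have rr: "(f, L2_rep A) \<in> L2_rel F M" using f by auto
  then show "L2_rep A \<in> L2_fun F M" by (auto simp: L2_rel_def)
  show "L2_class F M (L2_rep A) = A"
    using equiv_class_eq[OF equiv_L2_rel rr] f by (simp add: L2_class_def)
qed

lemma L2_rep_class:
  assumes "f \<in> L2_fun F M"
  shows "AE x in M. L2_rep (L2_class F M f) x = f x"
  using L2_rep[OF L2_class_carrier[OF assms]] assms L2_class_eq_iff by blast

lemma L2_eqI:
  assumes "A \<in> carrier (L2_space F M)" "B \<in> carrier (L2_space F M)" 
   "AE x in M. L2_rep A x = L2_rep B x"
 shows "A = B"
  using assms L2_rep L2_class_eq_iff by metis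

context
  fixes F :: "complex set" and M :: "'a measure"
  assumes F: "F \<in> {\<real>, UNIV}"
begin

private abbreviation "V \<equiv> L2_space F M"

lemma L2_add: 
  assumes "A \<in> carrier V" "B \<in> carrier V"
  shows "A \<oplus>\<^bsub>V\<^esub> B \<in> carrier V" "AE x in M. L2_rep (A \<oplus>\<^bsub>V\<^esub> B) x = L2_rep A x + L2_rep B x"
  using L2_fun_add[OF F L2_rep(1)[OF assms(1)] L2_rep(1)[OF assms(2)]] L2_class_carrier L2_rep_class 
  by (force simp: L2_space_def)+

lemma L2_smult: 
  assumes "c \<in> F" "A \<in> carrier V"
  shows "c \<odot>\<^bsub>V\<^esub> A \<in> carrier V" "AE x in M. L2_rep (c \<odot>\<^bsub>V\<^esub> A) x = c * L2_rep A x"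
  using L2_fun_mult[OF F assms(1) L2_rep(1)[OF assms(2)]] L2_class_carrier L2_rep_class 
  by (force simp: L2_space_def)+

lemma L2_zero: 
  shows "\<zero>\<^bsub>V\<^esub> \<in> carrier V" "AE x in M. L2_rep (\<zero>\<^bsub>V\<^esub>) x = 0"
  using L2_fun_zero[OF F, of M] L2_class_carrier L2_rep_class 
  by (force simp: L2_space_def)+

lemma L2_abelian: "abelian_group V"
proof (rule abelian_groupI)
  fix A B C assume [simp]: "A \<in> carrier V" "B \<in> carrier V" "C \<in> carrier V"
  show "(A \<oplus>\<^bsub>V\<^esub> B) \<oplus>\<^bsub>V\<^esub> C = A \<oplus>\<^bsub>V\<^esub> (B \<oplus>\<^bsub>V\<^esub> C)"
  proof (rule L2_eqI[where F = F and M = M])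
    show "AE x in M. L2_rep ((A \<oplus>\<^bsub>V\<^esub> B) \<oplus>\<^bsub>V\<^esub> C) x = L2_rep (A \<oplus>\<^bsub>V\<^esub> (B \<oplus>\<^bsub>V\<^esub> C)) x"
      using L2_add(2)[of A B] L2_add(2)[of B C] L2_add(2)[of "A \<oplus>\<^bsub>V\<^esub> B" C] L2_add(2)[of A "B \<oplus>\<^bsub>V\<^esub> C"] L2_add(1)[of A B] L2_add(1)[of B C]
      by auto
  qed (simp_all add: L2_add)
  show "A \<oplus>\<^bsub>V\<^esub> B = B \<oplus>\<^bsub>V\<^esub> A"
  proof (rule L2_eqI[where F = F and M = M])
    show "AE x in M. L2_rep (A \<oplus>\<^bsub>V\<^esub> B) x = L2_rep (B \<oplus>\<^bsub>V\<^esub> A) x"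
      using L2_add(2)[of A B] L2_add(2)[of B A] by auto
  qed (simp_all add: L2_add)
  show "\<zero>\<^bsub>V\<^esub> \<oplus>\<^bsub>V\<^esub> A = A"
  proof (rule L2_eqI[where F = F and M = M])
    show "AE x in M. L2_rep (\<zero>\<^bsub>V\<^esub> \<oplus>\<^bsub>V\<^esub> A) x = L2_rep A x"
      using L2_add(2)[of "\<zero>\<^bsub>V\<^esub>" A] L2_zero by auto
  qed (simp_all add: L2_add L2_zero)
  have m1: "-1 \<in> F" using F by auto
  have "((-1) \<odot>\<^bsub>V\<^esub> A) \<oplus>\<^bsub>V\<^esub> A = \<zero>\<^bsub>V\<^esub>"
  proof (rule L2_eqI[where F = F and M = M])
    show "AE x in M. L2_rep (((-1) \<odot>\<^bsub>V\<^esub> A) \<oplus>\<^bsub>V\<^esub> A) x = L2_rep \<zero>\<^bsub>V\<^esub> x"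
      using L2_add(2)[OF L2_smult(1)[OF m1, of A], of A] L2_zero L2_smult(2)[OF m1, of A] by auto
  qed (simp_all add: L2_add L2_zero L2_smult m1)
  then show "\<exists>y\<in>carrier V. y \<oplus>\<^bsub>V\<^esub> A = \<zero>\<^bsub>V\<^esub>" using L2_smult(1)[OF m1, of A] by auto
qed (simp_all add: L2_add L2_zero)

lemma L2_vs: "vectorspace (scalars F) V"
proof -
  have fd: "field (scalars F)" by (rule field_scalars[OF F])
  have cl: "1 \<in> F" "0 \<in> F" "\<And>x y. x \<in> F \<Longrightarrow> y \<in> F \<Longrightarrow> x + y \<in> F"
    "\<And>x y. x \<in> F \<Longrightarrow> y \<in> F \<Longrightarrow> x * y \<in> F"
    using F by auto
  have "module (scalars F) V"
  proof (rule moduleI)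
    show "cring (scalars F)" by (rule domain.axioms(1)[OF field.axioms(1)[OF fd]])
    show "abelian_group V" by (rule L2_abelian)
  next
    fix a A
    assume "a \<in> carrier (scalars F)" and AB: "A \<in> carrier V"
    then have ab: "a \<in> F" by (auto simp: scalars_def)
    show "a \<odot>\<^bsub>V\<^esub> A \<in> carrier V" using ab AB L2_smult by auto
  next
    fix a b A
    assume "a \<in> carrier (scalars F)" "b \<in> carrier (scalars F)" and AB: "A \<in> carrier V"
    then have ab: "a \<in> F" "b \<in> F" by (auto simp: scalars_def)
    show "(a \<oplus>\<^bsub>scalars F\<^esub> b) \<odot>\<^bsub>V\<^esub> A = a \<odot>\<^bsub>V\<^esub> A \<oplus>\<^bsub>V\<^esub> b \<odot>\<^bsub>V\<^esub> A"
    proof (rule L2_eqI[where F = F and M = M])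
      show "AE x in M. L2_rep ((a \<oplus>\<^bsub>scalars F\<^esub> b) \<odot>\<^bsub>V\<^esub> A) x = L2_rep (a \<odot>\<^bsub>V\<^esub> A \<oplus>\<^bsub>V\<^esub> b \<odot>\<^bsub>V\<^esub> A) x"
        using L2_smult(2)[OF ab(1) AB(1)] L2_smult(2)[OF ab(2) AB(1)] L2_smult(2)[OF cl(3)[OF ab] AB(1)]
          L2_add(2)[OF L2_smult(1)[OF ab(1) AB(1)] L2_smult(1)[OF ab(2) AB(1)]]
        by (auto simp: scalars_def algebra_simps)
    qed (use ab AB cl in \<open>auto simp: L2_add L2_smult scalars_def\<close>)
  next
    fix a A B
    assume "a \<in> carrier (scalars F)" and AB: "A \<in> carrier V" "B \<in> carrier V"
    then have ab: "a \<in> F" by (auto simp: scalars_def)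
    show "a \<odot>\<^bsub>V\<^esub> (A \<oplus>\<^bsub>V\<^esub> B) = a \<odot>\<^bsub>V\<^esub> A \<oplus>\<^bsub>V\<^esub> a \<odot>\<^bsub>V\<^esub> B"
    proof (rule L2_eqI[where F = F and M = M])
      show "AE x in M. L2_rep (a \<odot>\<^bsub>V\<^esub> (A \<oplus>\<^bsub>V\<^esub> B)) x = L2_rep (a \<odot>\<^bsub>V\<^esub> A \<oplus>\<^bsub>V\<^esub> a \<odot>\<^bsub>V\<^esub> B) x"
        using L2_smult(2)[OF ab AB(1)] L2_smult(2)[OF ab AB(2)] L2_smult(2)[OF ab L2_add(1)[OF AB]]
          L2_add(2)[OF AB] L2_add(2)[OF L2_smult(1)[OF ab AB(1)] L2_smult(1)[OF ab AB(2)]]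
        by (auto simp: algebra_simps)
    qed (use ab AB cl in \<open>auto simp: L2_add L2_smult\<close>)
  next
    fix a b A
    assume "a \<in> carrier (scalars F)" "b \<in> carrier (scalars F)" and AB: "A \<in> carrier V"
    then have ab: "a \<in> F" "b \<in> F" by (auto simp: scalars_def)
    show "(a \<otimes>\<^bsub>scalars F\<^esub> b) \<odot>\<^bsub>V\<^esub> A = a \<odot>\<^bsub>V\<^esub> (b \<odot>\<^bsub>V\<^esub> A)"
    proof (rule L2_eqI[where F = F and M = M])
      show "AE x in M. L2_rep ((a \<otimes>\<^bsub>scalars F\<^esub> b) \<odot>\<^bsub>V\<^esub> A) x = L2_rep (a \<odot>\<^bsub>V\<^esub> (b \<odot>\<^bsub>V\<^esub> A)) x"
        using L2_smult(2)[OF ab(1) L2_smult(1)[OF ab(2) AB(1)]] L2_smult(2)[OF ab(2) AB(1)] L2_smult(2)[OF cl(4)[OF ab] AB(1)]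
        by (auto simp: scalars_def algebra_simps)
    qed (use ab AB cl in \<open>auto simp: L2_smult scalars_def\<close>)
  next
    fix A
    assume AB: "A \<in> carrier V"
    show "\<one>\<^bsub>scalars F\<^esub> \<odot>\<^bsub>V\<^esub> A = A"
    proof (rule L2_eqI[where F = F and M = M])
      show "AE x in M. L2_rep (\<one>\<^bsub>scalars F\<^esub> \<odot>\<^bsub>V\<^esub> A) x = L2_rep A x"
        using L2_smult(2)[OF cl(1) AB(1)] by (auto simp: scalars_def)
    qed (use AB cl in \<open>auto simp: L2_smult scalars_def\<close>)
  qed
  with fd show ?thesis by (simp add: vectorspace_def)
qed

lemma L2_minus:
  assumes A: "A \<in> carrier V" and B: "B \<in> carrier V"
  shows "A \<ominus>\<^bsub>V\<^esub> B \<in> carrier V" "AE x in M. L2_rep (A \<ominus>\<^bsub>V\<^esub> B) x = L2_rep A x - L2_rep B x"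
proof -
  interpret abelian_group V by (rule L2_abelian)
  show c: "A \<ominus>\<^bsub>V\<^esub> B \<in> carrier V" using A B by simp
  have "(A \<ominus>\<^bsub>V\<^esub> B) \<oplus>\<^bsub>V\<^esub> B = A" using A B by (simp add: minus_eq a_assoc l_neg)
  then show "AE x in M. L2_rep (A \<ominus>\<^bsub>V\<^esub> B) x = L2_rep A x - L2_rep B x"
    using L2_add(2)[OF c B] by (auto simp: algebra_simps)
qed

lemma L2_iprod_integrable:
  assumes "f \<in> L2_fun F M" "g \<in> L2_fun F M"
  shows "integrable M (\<lambda>x. f x * cnj (g x))"
proof (rule Bochner_Integration.integrable_bound)
  have [measurable]: "f \<in> borel_measurable M" "g \<in> borel_measurable M"
    using assms by (auto simp: L2_fun_def)
  show "integrable M (\<lambda>x. (cmod (f x))\<^sup>2 + (cmod (g x))\<^sup>2)"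
    using assms by (auto simp: L2_fun_def)
  have "cmod (f x) * cmod (g x) \<le> (cmod (f x))\<^sup>2 + (cmod (g x))\<^sup>2" for x
    using sum_squares_bound[of "cmod (f x)" "cmod (g x)"] mult_nonneg_nonneg[of "cmod (f x)" "cmod (g x)"] 
      norm_ge_zero[of "f x"] norm_ge_zero[of "g x"] by linarith
  then show "AE x in M. norm (f x * cnj (g x)) \<le> norm ((cmod (f x))\<^sup>2 + (cmod (g x))\<^sup>2)"
    by (simp add: norm_mult)
  show "(\<lambda>x. f x * cnj (g x)) \<in> borel_measurable M"
    by (intro borel_measurable_times borel_measurable_continuous_on[of cnj] continuous_intros) auto
qed

lemma L2_iprod_self:
  assumes "A \<in> carrier V"
  shows "iprod V A A = of_real (LINT x|M. (cmod (L2_rep A x))\<^sup>2)"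
  by (simp add: L2_space_def flip: complex_norm_square integral_complex_of_real)

lemma L2_norm_sq:
  assumes "A \<in> carrier V"
  shows "(ip_norm V A)\<^sup>2 = (LINT x|M. (cmod (L2_rep A x))\<^sup>2)" "ip_norm V A \<ge> 0"
  unfolding ip_norm_def L2_iprod_self[OF assms] by auto

lemma L2_nn:
  assumes "A \<in> carrier V"
  shows "(\<integral>\<^sup>+x. ennreal ((cmod (L2_rep A x))\<^sup>2) \<partial>M) = ennreal ((ip_norm V A)\<^sup>2)"
  using L2_rep(1)[OF assms] unfolding L2_norm_sq[OF assms]
  by (intro nn_integral_eq_integral) (auto simp: L2_fun_def)

lemma L2_complete:
  assumes X: "range X \<subseteq> carrier V"
    and cau: "\<forall>e>0. \<exists>n0. \<forall>m\<ge>n0. \<forall>n\<ge>n0. ip_norm V (X m \<ominus>\<^bsub>V\<^esub> X n) < e"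
  shows "\<exists>A\<in>carrier V. (\<lambda>n. ip_norm V (X n \<ominus>\<^bsub>V\<^esub> A)) \<longlonglongrightarrow> 0"
proof -
  have Xc: "X n \<in> carrier V" for n using X by auto
  define f where "f n = L2_rep (X n)" for n
  have fL: "f n \<in> L2_fun F M" for n unfolding f_def by (rule L2_rep(1)[OF Xc])
  then have fm [measurable]: "f n \<in> borel_measurable M" for n by (auto simp: L2_fun_def)
  have dist: "(\<integral>\<^sup>+x. ennreal ((cmod (f m x - f n x))\<^sup>2) \<partial>M) = ennreal ((ip_norm V (X m \<ominus>\<^bsub>V\<^esub> X n))\<^sup>2)" for m n
    unfolding L2_nn[OF L2_minus(1)[OF Xc Xc], symmetric]
    by (rule nn_integral_cong_AE) (use L2_minus(2)[OF Xc[of m] Xc[of n]] in \<open>auto simp: f_def\<close>)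
  have "\<forall>k. \<exists>n0. \<forall>m\<ge>n0. \<forall>n\<ge>n0. ip_norm V (X m \<ominus>\<^bsub>V\<^esub> X n) < (1/2)^k" using cau by simp
  then obtain N where N: "\<And>k m n. m \<ge> N k \<Longrightarrow> n \<ge> N k \<Longrightarrow> ip_norm V (X m \<ominus>\<^bsub>V\<^esub> X n) < (1/2)^k"
    by metis
  define r where "r = rec_nat (N 0) (\<lambda>k p. max (Suc p) (N (Suc k)))"
  have rS: "r (Suc k) = max (Suc (r k)) (N (Suc k))" for k by (simp add: r_def)
  have rN: "r k \<ge> N k" for k by (cases k) (auto simp: r_def)
  have rmono: "strict_mono r" by (rule strict_mono_Suc_iff[THEN iffD2]) (simp add: rS less_eq_Suc_le)
  have rk: "ip_norm V (X (r (Suc k)) \<ominus>\<^bsub>V\<^esub> X (r k)) < (1/2)^k" for k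
    by (rule N) (use rN[of k] rS[of k] in auto)
  define g where "g k x = cmod (f (r (Suc k)) x - f (r k) x)" for k x
  have gm [measurable]: "g k \<in> borel_measurable M" for k unfolding g_def by measurable
  have "(\<integral>\<^sup>+x. (\<Sum>k. ennreal (2^k * (g k x)\<^sup>2)) \<partial>M) = (\<Sum>k. \<integral>\<^sup>+x. ennreal (2^k * (g k x)\<^sup>2) \<partial>M)"
    by (rule nn_integral_suminf) measurable
  also have "\<dots> \<le> (\<Sum>k. ennreal ((1/2)^k))"
  proof (rule suminf_le)
    fix k
    have "(\<integral>\<^sup>+x. ennreal (2^k * (g k x)\<^sup>2) \<partial>M) = ennreal (2^k) * (\<integral>\<^sup>+x. ennreal ((g k x)\<^sup>2) \<partial>M)"
      by (simp add: ennreal_mult nn_integral_cmult)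
    also have "\<dots> = ennreal (2^k * (ip_norm V (X (r (Suc k)) \<ominus>\<^bsub>V\<^esub> X (r k)))\<^sup>2)"
      unfolding g_def dist by (simp add: ennreal_mult)
    also have "\<dots> \<le> ennreal (2^k * ((1/2)^k)\<^sup>2)"
      using rk[of k] L2_norm_sq(2)[OF L2_minus(1)[OF Xc Xc]]
      by (intro ennreal_leI mult_left_mono power_mono) (auto intro: less_imp_le)
    also have "2^k * ((1/2)^k)\<^sup>2 = ((1/2)^k :: real)"
      by (simp add: power2_eq_square power_divide field_simps)
    finally show "(\<integral>\<^sup>+x. ennreal (2^k * (g k x)\<^sup>2) \<partial>M) \<le> ennreal ((1/2)^k)" .
  qed auto
  also have "\<dots> < \<infinity>"
    by (subst suminf_ennreal2) (auto intro: summable_geometric)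
  finally have "AE x in M. (\<Sum>k. ennreal (2^k * (g k x)\<^sup>2)) \<noteq> \<infinity>"
    by (intro nn_integral_PInf_AE) auto
  then have conv: "AE x in M. convergent (\<lambda>k. f (r k) x)"
  proof eventually_elim
    case (elim x)
    then have sm: "summable (\<lambda>k. 2^k * (g k x)\<^sup>2)"
      by (intro summable_suminf_not_top) (auto simp: top_ennreal_def)
    then have "(\<lambda>k. 2^k * (g k x)\<^sup>2) \<longlonglongrightarrow> 0" by (rule summable_LIMSEQ_zero)
    then have ev: "eventually (\<lambda>k. 2^k * (g k x)\<^sup>2 < 1) sequentially" 
      by (rule order_tendstoD) simp
    have "summable (\<lambda>k. f (r (Suc k)) x - f (r k) x)"
    proof (rule summable_comparison_test_ev)
      show "eventually (\<lambda>k. norm (f (r (Suc k)) x - f (r k) x) \<le> (1 / sqrt 2)^k) sequentially"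
        using ev
      proof eventually_elim
        case (elim k)
        have "(g k x)\<^sup>2 \<le> ((1 / sqrt 2)^k)\<^sup>2"
        proof -
          have "((1 / sqrt 2)^k)\<^sup>2 = (1/2::real)^k"
            by (metis power_mult power_divide real_sqrt_pow2 zero_le_numeral mult.commute power_one)
          then show ?thesis using elim by (simp add: field_simps power_divide)
        qed
        then have "g k x \<le> (1 / sqrt 2)^k" by (rule power2_le_imp_le) simp
        then show ?case by (simp add: g_def)
      qed
      show "summable (\<lambda>k. (1 / sqrt 2)^k)" by (rule summable_geometric) simp
    qed
    then have "convergent (\<lambda>n. \<Sum>k<n. f (r (Suc k)) x - f (r k) x)" by (simp add: summable_iff_convergent)
    then have "convergent (\<lambda>n. f (r n) x - f (r 0) x)" using sum_lessThan_telescope[of "\<lambda>k. f (r k) x"] by simp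
    then show "convergent (\<lambda>k. f (r k) x)" using convergent_diff_const_right_iff by blast
  qed
  define h where "h x = (if convergent (\<lambda>k. f (r k) x) then lim (\<lambda>k. f (r k) x) else 0)" for x
  have hm [measurable]: "h \<in> borel_measurable M" 
    unfolding h_def Cauchy_convergent_iff[symmetric]
    by (intro measurable_If borel_measurable_lim_metric sets_Collect_Cauchy) measurable
  have hlim: "AE x in M. (\<lambda>k. f (r k) x) \<longlonglongrightarrow> h x"
    using conv by eventually_elim (auto simp: h_def convergent_LIMSEQ_iff)
  have clF: "closed F" "0 \<in> F" using F closed_complex_Reals by auto
  have hF: "h x \<in> F" if "x \<in> space M" for x
  proof (cases "convergent (\<lambda>k. f (r k) x)")
    case True
    then have "(\<lambda>k. f (r k) x) \<longlonglongrightarrow> h x" by (auto simp: h_def convergent_LIMSEQ_iff)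
    then show ?thesis by (rule closed_sequentially[OF clF(1), rotated]) (use fL that in \<open>auto simp: L2_fun_def\<close>)
  qed (simp add: h_def clF)
  have fatou: "(\<integral>\<^sup>+x. ennreal ((cmod (f n x - h x))\<^sup>2) \<partial>M) \<le> ennreal (e\<^sup>2)"
    if n: "\<And>m. m \<ge> n0 \<Longrightarrow> ip_norm V (X n \<ominus>\<^bsub>V\<^esub> X m) < e" for n n0 e
  proof -
    have "(\<integral>\<^sup>+x. ennreal ((cmod (f n x - h x))\<^sup>2) \<partial>M) = (\<integral>\<^sup>+x. liminf (\<lambda>k. ennreal ((cmod (f n x - f (r k) x))\<^sup>2)) \<partial>M)"
    proof (rule nn_integral_cong_AE, use hlim in eventually_elim)
      case (elim x)
      then have L: "(\<lambda>k. ennreal ((cmod (f n x - f (r k) x))\<^sup>2)) \<longlonglongrightarrow> ennreal ((cmod (f n x - h x))\<^sup>2)"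
        by (intro tendsto_ennrealI tendsto_intros)
      show ?case by (rule lim_imp_Liminf[OF sequentially_bot L, symmetric])
    qed
    also have "\<dots> \<le> liminf (\<lambda>k. \<integral>\<^sup>+x. ennreal ((cmod (f n x - f (r k) x))\<^sup>2) \<partial>M)"
      by (rule nn_integral_liminf) measurable
    also have "\<dots> \<le> ennreal (e\<^sup>2)"
    proof (rule Liminf_le)
      show "eventually (\<lambda>k. (\<integral>\<^sup>+x. ennreal ((cmod (f n x - f (r k) x))\<^sup>2) \<partial>M) \<le> ennreal (e\<^sup>2)) sequentially"
        using eventually_ge_at_top[of n0]
      proof eventually_elim
        case (elim k)
        then have "r k \<ge> n0" using seq_suble[OF rmono, of k] by simp
        then show ?case unfolding dist 
          using n[of "r k"] L2_norm_sq(2)[OF L2_minus(1)[OF Xc Xc], of n "r k"] 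
          by (intro ennreal_leI power_mono) auto
      qed
    qed simp
    finally show ?thesis .
  qed
  have hL: "h \<in> L2_fun F M"
  proof -
    obtain n0 where n0: "\<And>m n. m \<ge> n0 \<Longrightarrow> n \<ge> n0 \<Longrightarrow> ip_norm V (X m \<ominus>\<^bsub>V\<^esub> X n) < 1" using cau[rule_format, of 1] by auto
    have "(\<integral>\<^sup>+x. ennreal ((cmod (f n0 x - h x))\<^sup>2) \<partial>M) \<le> ennreal (1\<^sup>2)"
      by (rule fatou) (use n0 in auto)
    then have "integrable M (\<lambda>x. (cmod (f n0 x - h x))\<^sup>2)"
      by (intro integrableI_bounded) (auto intro: order_le_less_trans[OF _ ennreal_one_less_top])
    then have "(\<lambda>x. f n0 x - h x) \<in> L2_fun F M"
      using hF fL[of n0] F by (auto simp: L2_fun_def)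
    from L2_fun_diff[OF F fL[of n0] this] show ?thesis by simp
  qed
  define A where "A = L2_class F M h"
  have Ac: "A \<in> carrier V" unfolding A_def by (rule L2_class_carrier[OF hL])
  have dA: "ennreal ((ip_norm V (X n \<ominus>\<^bsub>V\<^esub> A))\<^sup>2) = (\<integral>\<^sup>+x. ennreal ((cmod (f n x - h x))\<^sup>2) \<partial>M)" for n
    unfolding L2_nn[OF L2_minus(1)[OF Xc Ac], symmetric]
    by (rule nn_integral_cong_AE) (use L2_minus(2)[OF Xc[of n] Ac] L2_rep_class[OF hL] in \<open>auto simp: f_def A_def\<close>)
  have "(\<lambda>n. ip_norm V (X n \<ominus>\<^bsub>V\<^esub> A)) \<longlonglongrightarrow> 0"
  proof (rule LIMSEQ_I)
    fix e :: real assume e: "e > 0"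
    obtain n0 where n0: "\<And>m n. m \<ge> n0 \<Longrightarrow> n \<ge> n0 \<Longrightarrow> ip_norm V (X m \<ominus>\<^bsub>V\<^esub> X n) < e/2" using cau[rule_format, OF half_gt_zero[OF e]] by blast
    have "ip_norm V (X n \<ominus>\<^bsub>V\<^esub> A) < e" if "n \<ge> n0" for n
    proof -
      have "ennreal ((ip_norm V (X n \<ominus>\<^bsub>V\<^esub> A))\<^sup>2) \<le> ennreal ((e/2)\<^sup>2)"
        unfolding dA by (rule fatou) (use n0 that in auto)
      then have "(ip_norm V (X n \<ominus>\<^bsub>V\<^esub> A))\<^sup>2 \<le> (e/2)\<^sup>2" by (simp add: ennreal_le_iff)
      then have "ip_norm V (X n \<ominus>\<^bsub>V\<^esub> A) \<le> e/2" by (rule power2_le_imp_le) (use e in simp)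
      then show ?thesis using e by simp
    qed
    then show "\<exists>no. \<forall>n\<ge>no. norm (ip_norm V (X n \<ominus>\<^bsub>V\<^esub> A) - 0) < e"
      using L2_norm_sq(2)[OF L2_minus(1)[OF Xc Ac]] by auto
  qed
  with Ac show ?thesis by blast
qed

theorem hilbert_space_L2: "hilbert_space F (L2_space F M)"
  unfolding hilbert_space_def
proof (intro conjI ballI allI impI)
  show "vectorspace (scalars F) V" by (rule L2_vs)
next
  fix A B assume c: "A \<in> carrier V" "B \<in> carrier V"
  note m = L2_rep(1)[OF c(1)] L2_rep(1)[OF c(2)]
  show "iprod V A B \<in> F"
  proof (cases "F = \<real>")
    case True
    have "L2_rep A x * cnj (L2_rep B x) = of_real (Re (L2_rep A x * cnj (L2_rep B x)))" if "x \<in> space M" for x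
      using m that True by (force simp: L2_fun_def complex_is_Real_iff complex_eq_iff)
    then have "iprod V A B = (LINT x|M. of_real (Re (L2_rep A x * cnj (L2_rep B x))))"
      by (auto simp: L2_space_def intro!: Bochner_Integration.integral_cong)
    then show ?thesis using True by (metis integral_complex_of_real Reals_of_real)
  qed (use F in auto)
  show "iprod V B A = cnj (iprod V A B)"
    using Bochner_Integration.integral_cnj[of M "\<lambda>x. L2_rep A x * cnj (L2_rep B x)"] by (simp add: L2_space_def mult.commute)
next
  fix A B C assume c: "A \<in> carrier V" "B \<in> carrier V" "C \<in> carrier V"
  note m = L2_rep(1)[OF c(1)] L2_rep(1)[OF c(2)] L2_rep(1)[OF c(3)]
  have mm: "(\<lambda>x. L2_rep D x * cnj (L2_rep E x)) \<in> borel_measurable M" if "D \<in> carrier V" "E \<in> carrier V" for D E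
    using L2_iprod_integrable[OF L2_rep(1)[OF that(1)] L2_rep(1)[OF that(2)]] by simp
  have "iprod V (A \<oplus>\<^bsub>V\<^esub> B) C = (LINT x|M. L2_rep (A \<oplus>\<^bsub>V\<^esub> B) x * cnj (L2_rep C x))" by (simp add: L2_space_def)
  also have "\<dots> = (LINT x|M. L2_rep A x * cnj (L2_rep C x) + L2_rep B x * cnj (L2_rep C x))"
    by (rule integral_cong_AE) (use L2_add(2)[OF c(1,2)] mm L2_add(1) c in \<open>auto simp: distrib_right\<close>)
  also have "\<dots> = iprod V A C + iprod V B C"
    using L2_iprod_integrable[OF m(1,3)] L2_iprod_integrable[OF m(2,3)] by (simp add: L2_space_def)
  finally show "iprod V (A \<oplus>\<^bsub>V\<^esub> B) C = iprod V A C + iprod V B C" .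
next
  fix a A C assume a: "a \<in> F" and c: "A \<in> carrier V" "C \<in> carrier V"
  have mm: "(\<lambda>x. L2_rep D x * cnj (L2_rep E x)) \<in> borel_measurable M" if "D \<in> carrier V" "E \<in> carrier V" for D E
    using L2_iprod_integrable[OF L2_rep(1)[OF that(1)] L2_rep(1)[OF that(2)]] by simp
  have "iprod V (a \<odot>\<^bsub>V\<^esub> A) C = (LINT x|M. L2_rep (a \<odot>\<^bsub>V\<^esub> A) x * cnj (L2_rep C x))" by (simp add: L2_space_def)
  also have "\<dots> = (LINT x|M. a * (L2_rep A x * cnj (L2_rep C x)))"
    by (rule integral_cong_AE) (use L2_smult(2)[OF a c(1)] mm L2_smult(1)[OF a] c in \<open>auto simp: mult.assoc\<close>)
  also have "\<dots> = a * iprod V A C" by (simp add: L2_space_def)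
  finally show "iprod V (a \<odot>\<^bsub>V\<^esub> A) C = a * iprod V A C" .
next
  fix A assume c: "A \<in> carrier V" and nz: "A \<noteq> \<zero>\<^bsub>V\<^esub>"
  have i: "integrable M (\<lambda>x. (cmod (L2_rep A x))\<^sup>2)" using L2_rep(1)[OF c] by (simp add: L2_fun_def)
  have "(LINT x|M. (cmod (L2_rep A x))\<^sup>2) \<noteq> 0"
  proof
    assume "(LINT x|M. (cmod (L2_rep A x))\<^sup>2) = 0"
    then have "AE x in M. L2_rep A x = 0" using integral_nonneg_eq_0_iff_AE[OF i] by auto
    then have "A = \<zero>\<^bsub>V\<^esub>" by (intro L2_eqI[OF c L2_zero(1)]) (use L2_zero(2) in auto)
    with nz show False by simp
  qed
  moreover have "(LINT x|M. (cmod (L2_rep A x))\<^sup>2) \<ge> 0" by simp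
  ultimately show "Re (iprod V A A) > 0" unfolding L2_iprod_self[OF c] by (simp del: integral_nonneg add: order_less_le)
next
  fix X :: "nat \<Rightarrow> ('a \<Rightarrow> complex) set"
  assume "range X \<subseteq> carrier V" "\<forall>e>0. \<exists>n0. \<forall>m\<ge>n0. \<forall>n\<ge>n0. ip_norm V (X m \<ominus>\<^bsub>V\<^esub> X n) < e"
  then show "\<exists>x\<in>carrier V. (\<lambda>n. ip_norm V (X n \<ominus>\<^bsub>V\<^esub> x)) \<longlonglongrightarrow> 0" by (rule L2_complete)
qed

end

end

theory Submission
  imports Defs
begin

text \<open>
  Let \<open>g \<in> V\<^sub>r\<close> represent the restriction of \<open>l\<close> to \<open>V\<^sub>r\<close>, and let \<open>T u \<in> V\<^sub>r\<close> represent \<open>B u\<close>.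
  Then \<open>B u - l\<close> is the functional represented by \<open>T u - g\<close> minus one that vanishes on \<open>V\<^sub>r\<close>,
  so \<open>\<parallel>B u - l\<parallel>\<^sup>2 = \<parallel>T u - g\<parallel>\<^sup>2 + C\<close> with \<open>C\<close> independent of \<open>u\<close>, while \<open>T u - g\<close> is exactly the
  discrete Riesz representative of \<open>B u - l\<close>. Proving this Pythagorean identity directly for
  the dual norm, with one well-chosen test vector, avoids the Riesz representation theorem on \<open>V\<close>.

  For the matrices, \<open>L u\<^sub>j \<in> V\<^sub>r\<close>; if \<open>Y\<close> holds the coordinates of the \<open>L u\<^sub>j\<close> then \<open>B = G Y\<close>,
  whence \<open>B\<^sup>* G\<^sup>-\<^sup>1 B = B\<^sup>* Y\<close>, whose entries are \<open>(L u\<^sub>j, L u\<^sub>i)\<close>.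
\<close>

section \<open>Inner product spaces over the scalar field\<close>

lemma scalars_simps [simp]:
  "carrier (scalars F) = F" "\<zero>\<^bsub>scalars F\<^esub> = 0" "\<one>\<^bsub>scalars F\<^esub> = 1"
  "x \<oplus>\<^bsub>scalars F\<^esub> y = x + y" "x \<otimes>\<^bsub>scalars F\<^esub> y = x * y"
  by (simp_all add: scalars_def)

text \<open>Carries neither boundedness nor extensionality, so the maps \<open>ip x\<close> qualify
  as they stand and the property passes to subspaces without restricting the function.\<close>

definition antilinear ::
  "complex set \<Rightarrow> (complex, 'v, 'x) module_scheme \<Rightarrow> ('v \<Rightarrow> complex) \<Rightarrow> bool" where
  "antilinear F V f \<longleftrightarrow>
     f \<in> carrier V \<rightarrow> F \<and>
     (\<forall>x\<in>carrier V. \<forall>y\<in>carrier V. f (x \<oplus>\<^bsub>V\<^esub> y) = f x + f y) \<and>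
     (\<forall>c\<in>F. \<forall>x\<in>carrier V. f (c \<odot>\<^bsub>V\<^esub> x) = cnj c * f x)"

text \<open>
  The form is separate from the record so that \<open>U\<^sub>h\<close> can carry the form pulled back from \<open>V\<close>.
\<close>

locale inner_product_space = vectorspace "scalars F" V
  for F :: "complex set" and V :: "(complex, 'v, 'x) module_scheme" +
  fixes ip :: "'v \<Rightarrow> 'v \<Rightarrow> complex"
  assumes F: "F \<in> {\<real>, UNIV}"
    and ip_closed: "\<lbrakk>x \<in> carrier V; y \<in> carrier V\<rbrakk> \<Longrightarrow> ip x y \<in> F"
    and ip_add_left: "\<lbrakk>x \<in> carrier V; y \<in> carrier V; z \<in> carrier V\<rbrakk> \<Longrightarrow>
          ip (x \<oplus>\<^bsub>V\<^esub> y) z = ip x z + ip y z"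
    and ip_smult_left: "\<lbrakk>c \<in> F; x \<in> carrier V; y \<in> carrier V\<rbrakk> \<Longrightarrow> ip (c \<odot>\<^bsub>V\<^esub> x) y = c * ip x y"
    and ip_commute: "\<lbrakk>x \<in> carrier V; y \<in> carrier V\<rbrakk> \<Longrightarrow> ip y x = cnj (ip x y)"
    and ip_pos: "\<lbrakk>x \<in> carrier V; x \<noteq> \<zero>\<^bsub>V\<^esub>\<rbrakk> \<Longrightarrow> Re (ip x x) > 0"
begin

lemma F_closed:
  "0 \<in> F" "1 \<in> F" "x \<in> F \<Longrightarrow> y \<in> F \<Longrightarrow> x + y \<in> F" "x \<in> F \<Longrightarrow> y \<in> F \<Longrightarrow> x - y \<in> F"
  "x \<in> F \<Longrightarrow> y \<in> F \<Longrightarrow> x * y \<in> F" "x \<in> F \<Longrightarrow> y \<in> F \<Longrightarrow> x / y \<in> F" "x \<in> F \<Longrightarrow> - x \<in> F"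
  "complex_of_real r \<in> F"
  using F by auto

lemma ip_zero_left [simp]: "x \<in> carrier V \<Longrightarrow> ip \<zero>\<^bsub>V\<^esub> x = 0"
  using ip_add_left[of "\<zero>\<^bsub>V\<^esub>" "\<zero>\<^bsub>V\<^esub>" x] by simp

lemma ip_minus_left:
  assumes "x \<in> carrier V" "y \<in> carrier V" "z \<in> carrier V"
  shows "ip (x \<ominus>\<^bsub>V\<^esub> y) z = ip x z - ip y z"
proof -
  have "ip (y \<oplus>\<^bsub>V\<^esub> (\<ominus>\<^bsub>V\<^esub> y)) z = 0" using assms by (simp add: M.r_neg)
  then have "ip (\<ominus>\<^bsub>V\<^esub> y) z = - ip y z"
    using assms ip_add_left[of y "\<ominus>\<^bsub>V\<^esub> y" z] by (simp add: add_eq_0_iff)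
  then show ?thesis
    using assms ip_add_left[of x "\<ominus>\<^bsub>V\<^esub> y" z] by (simp add: a_minus_def)
qed

lemma ip_zero_right [simp]: "x \<in> carrier V \<Longrightarrow> ip x \<zero>\<^bsub>V\<^esub> = 0"
  using ip_commute[of "\<zero>\<^bsub>V\<^esub>" x] by simp

lemma ip_add_right:
  "\<lbrakk>x \<in> carrier V; y \<in> carrier V; z \<in> carrier V\<rbrakk> \<Longrightarrow> ip z (x \<oplus>\<^bsub>V\<^esub> y) = ip z x + ip z y"
  using ip_commute[of "x \<oplus>\<^bsub>V\<^esub> y" z] ip_commute[of x z] ip_commute[of y z] ip_add_left by simp

lemma ip_minus_right:
  "\<lbrakk>x \<in> carrier V; y \<in> carrier V; z \<in> carrier V\<rbrakk> \<Longrightarrow> ip z (x \<ominus>\<^bsub>V\<^esub> y) = ip z x - ip z y"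
  using ip_commute[of "x \<ominus>\<^bsub>V\<^esub> y" z] ip_commute[of x z] ip_commute[of y z] ip_minus_left by simp

lemma ip_smult_right:
  "\<lbrakk>c \<in> F; x \<in> carrier V; y \<in> carrier V\<rbrakk> \<Longrightarrow> ip y (c \<odot>\<^bsub>V\<^esub> x) = cnj c * ip y x"
  using ip_commute[of "c \<odot>\<^bsub>V\<^esub> x" y] ip_commute[of x y] ip_smult_left by simp

lemmas ip_simps = ip_add_left ip_add_right ip_minus_left ip_minus_right
  ip_smult_left ip_smult_right

lemma ip_self_real: "x \<in> carrier V \<Longrightarrow> ip x x = of_real (Re (ip x x))"
  using ip_commute[of x x] by (metis Reals_cnj_iff complex_is_Real_iff of_real_Re)

lemma ip_self_eq_0: "x \<in> carrier V \<Longrightarrow> Re (ip x x) \<le> 0 \<Longrightarrow> x = \<zero>\<^bsub>V\<^esub>"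
  using ip_pos[of x] by force

lemma ip_self_nonneg: "x \<in> carrier V \<Longrightarrow> Re (ip x x) \<ge> 0"
  using ip_pos[of x] by (cases "x = \<zero>\<^bsub>V\<^esub>") auto

lemma antilinear_ip: "x \<in> carrier V \<Longrightarrow> antilinear F V (ip x)"
  by (auto simp: antilinear_def ip_closed ip_simps)

text \<open>Test with \<open>x \<ominus> y\<close> itself. Later proofs use this as an
  extensionality rule that reduces vector identities to scalar identities between inner
  products.\<close>

lemma ip_left_cancel:
  assumes "x \<in> carrier V" "y \<in> carrier V" "\<And>z. z \<in> carrier V \<Longrightarrow> ip x z = ip y z"
  shows "x = y"
proof -
  have "ip (x \<ominus>\<^bsub>V\<^esub> y) (x \<ominus>\<^bsub>V\<^esub> y) = 0" using assms by (simp add: ip_minus_left)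
  then have "x \<ominus>\<^bsub>V\<^esub> y = \<zero>\<^bsub>V\<^esub>" using assms by (intro ip_self_eq_0) auto
  then show ?thesis using assms by simp
qed

section \<open>Riesz representation in finite dimension\<close>

text \<open>The set where \<open>f\<close> and \<open>g\<close> agree is a submodule containing
  \<open>S\<close>. It contains zero because additivity at zero forces both functionals to vanish
  there.\<close>

lemma antilinear_eq_on_span:
  assumes f: "antilinear F V f" and g: "antilinear F V g" and S: "S \<subseteq> carrier V"
    and eq: "\<And>v. v \<in> S \<Longrightarrow> f v = g v" and v: "v \<in> span S"
  shows "f v = g v"
proof -
  have "f (\<zero>\<^bsub>V\<^esub> \<oplus>\<^bsub>V\<^esub> \<zero>\<^bsub>V\<^esub>) = f \<zero>\<^bsub>V\<^esub> + f \<zero>\<^bsub>V\<^esub>" "g (\<zero>\<^bsub>V\<^esub> \<oplus>\<^bsub>V\<^esub> \<zero>\<^bsub>V\<^esub>) = g \<zero>\<^bsub>V\<^esub> + g \<zero>\<^bsub>V\<^esub>"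
    using f g unfolding antilinear_def by blast+
  then have "submodule (scalars F) {v \<in> carrier V. f v = g v} V"
    using f g by (auto simp: submodule_def antilinear_def module_axioms)
  then have "span S \<subseteq> {v \<in> carrier V. f v = g v}"
    by (intro span_is_subset) (use S eq in auto)
  then show ?thesis using v by auto
qed

text \<open>A Gram-Schmidt step: \<open>e\<close> is the component of the new vector orthogonal to the others.\<close>

lemma interpolation:
  assumes "finite A" "A \<subseteq> carrier V" "lin_indpt A" "f \<in> A \<rightarrow> F"
  shows "\<exists>g\<in>span A. \<forall>a\<in>A. ip g a = f a"
  using assms
proof (induction A arbitrary: f rule: finite_induct)
  case empty
  show ?case using submodule.zero_closed[OF span_is_submodule[of "{}"]] by auto
next
  case (insert b A)
  have A: "A \<subseteq> carrier V" and b: "b \<in> carrier V" using insert.prems by auto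
  have li: "lin_indpt A" using subset_li_is_li[OF insert.prems(2)] by auto
  \<comment> \<open>The hypothesis serves two different data: the values of \<open>ip b\<close> and
    the prescribed \<open>f\<close>.\<close>
  have IH: "\<exists>g\<in>span A. \<forall>a\<in>A. ip g a = f a" if "f \<in> A \<rightarrow> F" for f
    using insert.IH[OF A li that] .
  have "b \<notin> span A" using lin_dep_iff_in_span[OF A li b] insert by auto
  have sub: "submodule (scalars F) (span (insert b A)) V"
    using insert.prems by (intro span_is_submodule)
  have le: "span A \<subseteq> span (insert b A)" by (rule span_is_monotone) auto
  have sA: "span A \<subseteq> carrier V" by (rule span_is_subset2[OF A])
  have bs: "b \<in> span (insert b A)" using in_own_span[OF insert.prems(1)] by auto
  \<comment> \<open>\<open>p\<close> is the orthogonal projection of \<open>b\<close> onto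
    \<open>span A\<close>.\<close>
  obtain p where p: "p \<in> span A" "\<And>a. a \<in> A \<Longrightarrow> ip p a = ip b a"
    using IH[of "ip b"] A b ip_closed by blast
  have pc: "p \<in> carrier V" using p sA by auto
  define e where "e = b \<ominus>\<^bsub>V\<^esub> p"
  have ec: "e \<in> carrier V" using b pc by (simp add: e_def)
  \<comment> \<open>The submodule rules speak of sums and scalar multiples, so the difference is
    rewritten in these terms.\<close>
  have "e = b \<oplus>\<^bsub>V\<^esub> (-1) \<odot>\<^bsub>V\<^esub> p"
  proof (rule ip_left_cancel)
    show "ip e z = ip (b \<oplus>\<^bsub>V\<^esub> (-1) \<odot>\<^bsub>V\<^esub> p) z" if "z \<in> carrier V" for z
      using that b pc F_closed by (simp add: e_def ip_simps)
  qed (use b pc ec F_closed in auto)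
  then have es: "e \<in> span (insert b A)"
    using submodule.m_closed[OF sub bs] submodule.smult_closed[OF sub, of "-1" p] p le F_closed
    by auto
  have eA: "ip e a = 0" if "a \<in> A" for a
    using that p(2)[OF that] A b pc by (auto simp: e_def ip_minus_left)
  have orth: "ip e s = 0" if "s \<in> span A" for s
    using antilinear_eq_on_span[OF antilinear_ip[OF ec], of "\<lambda>_. 0" A s] eA that A F_closed
    by (auto simp: antilinear_def)
  have "e \<noteq> \<zero>\<^bsub>V\<^esub>" using \<open>b \<notin> span A\<close> p(1) b pc by (auto simp: e_def)
  then have ee: "ip e e \<noteq> 0" using ip_pos[OF ec] by auto
  \<comment> \<open>Since \<open>e\<close> is orthogonal to \<open>p\<close>, its product with
    \<open>b\<close> is \<open>ip e e\<close>, which is nonzero.\<close>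
  have "ip e e = ip e b - ip e p" using b pc ec ip_minus_right[of b p e] by (simp add: e_def)
  then have eb: "ip e b = ip e e" using orth[OF p(1)] by simp
  obtain g where g: "g \<in> span A" "\<And>a. a \<in> A \<Longrightarrow> ip g a = f a"
    using IH[of f] insert.prems by auto
  have gc: "g \<in> carrier V" using g sA by auto
  \<comment> \<open>Adding a multiple of \<open>e\<close> leaves the values on \<open>A\<close>
    alone; \<open>c\<close> is the multiple that corrects the value at \<open>b\<close>.\<close>
  define c where "c = (f b - ip g b) / ip e e"
  have cF: "c \<in> F" unfolding c_def using insert.prems(3) ip_closed gc b ec F_closed by auto
  have "g \<oplus>\<^bsub>V\<^esub> c \<odot>\<^bsub>V\<^esub> e \<in> span (insert b A)"
    using submodule.m_closed[OF sub] submodule.smult_closed[OF sub] g(1) le es cF by auto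
  moreover have "ip (g \<oplus>\<^bsub>V\<^esub> c \<odot>\<^bsub>V\<^esub> e) a = f a" if "a \<in> insert b A" for a
  proof -
    have ac: "a \<in> carrier V" using that A b by auto
    have "ip (g \<oplus>\<^bsub>V\<^esub> c \<odot>\<^bsub>V\<^esub> e) a = ip g a + c * ip e a"
      using ac gc ec cF by (simp add: ip_simps)
    then show ?thesis using that g(2) eA eb ee by (auto simp: c_def)
  qed
  ultimately show ?case by blast
qed

text \<open>Interpolate the values of \<open>f\<close> on a basis; agreement spreads to the whole
  space by antilinearity.\<close>

lemma fin_dim_riesz:
  assumes "fin_dim" "antilinear F V f"
  obtains g where "g \<in> carrier V" "\<And>v. v \<in> carrier V \<Longrightarrow> ip g v = f v"
proof -
  obtain A where A: "finite A" "basis A" using finite_basis_exists[OF assms(1)] by auto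
  then have Ac: "A \<subseteq> carrier V" "span A = carrier V" "lin_indpt A" by (auto simp: basis_def)
  have "f \<in> A \<rightarrow> F" using assms(2) Ac by (auto simp: antilinear_def)
  then have "\<exists>g\<in>carrier V. \<forall>a\<in>A. ip g a = f a"
    using interpolation[OF A(1) Ac(1,3)] unfolding Ac(2) by simp
  then obtain g where g: "g \<in> carrier V" "\<And>a. a \<in> A \<Longrightarrow> ip g a = f a" by blast
  have "ip g v = f v" if "v \<in> carrier V" for v
    using that antilinear_eq_on_span[OF antilinear_ip[OF g(1)] assms(2) Ac(1) g(2), of v]
    unfolding Ac(2) by simp
  then show thesis using that g by blast
qed

lemma subspace_inner_product_space:
  assumes W: "subspace (scalars F) W V"
  shows "inner_product_space F (V\<lparr>carrier := W\<rparr>) ip"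
  unfolding inner_product_space_def inner_product_space_axioms_def
proof (intro conjI allI impI)
  have sub: "W \<subseteq> carrier V" using submodule.subset[OF is_module[OF W]] .
  show "vectorspace (scalars F) (V\<lparr>carrier := W\<rparr>)" by (rule subspace_is_vs[OF W])
  show "F \<in> {\<real>, UNIV}" by (rule F)
  show "ip y x = cnj (ip x y)"
    if "x \<in> carrier (V\<lparr>carrier := W\<rparr>)" "y \<in> carrier (V\<lparr>carrier := W\<rparr>)" for x y
    using that sub by (intro ip_commute) auto
qed (use submodule.subset[OF is_module[OF W]] in
    \<open>auto simp: subset_iff ip_closed ip_add_left ip_smult_left ip_pos\<close>)

lemma riesz_subspace:
  assumes W: "subspace (scalars F) W V" and fd: "vectorspace.fin_dim (scalars F) (V\<lparr>carrier := W\<rparr>)"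
    and f: "antilinear F V f"
  obtains g where "g \<in> W" "\<And>v. v \<in> W \<Longrightarrow> ip g v = f v"
proof -
  have sub: "W \<subseteq> carrier V" using submodule.subset[OF is_module[OF W]] .
  interpret W: inner_product_space F "V\<lparr>carrier := W\<rparr>" ip
    by (rule subspace_inner_product_space[OF W])
  have "antilinear F (V\<lparr>carrier := W\<rparr>) f" using f sub by (auto simp: antilinear_def subset_iff)
  then show thesis using W.fin_dim_riesz[OF fd] that by auto
qed

section \<open>Linear least squares\<close>

text \<open>The two equations say that \<open>b \<ominus> g\<close> is orthogonal to
  \<open>a\<close> and to \<open>b\<close>, hence to \<open>a \<ominus> b\<close>; the claim is
  Pythagoras for the sum of these two differences.\<close>

lemma ip_sub_sub_eq:
  assumes "a \<in> carrier V" "b \<in> carrier V" "g \<in> carrier V"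
    and "ip b a = ip g a" "ip b b = ip g b"
  shows "Re (ip (a \<ominus>\<^bsub>V\<^esub> g) (a \<ominus>\<^bsub>V\<^esub> g)) =
         Re (ip (b \<ominus>\<^bsub>V\<^esub> g) (b \<ominus>\<^bsub>V\<^esub> g)) + Re (ip (a \<ominus>\<^bsub>V\<^esub> b) (a \<ominus>\<^bsub>V\<^esub> b))"
proof -
  have "ip a g = ip a b" "ip b g = cnj (ip b b)"
    using assms ip_commute[of g a] ip_commute[of b a] ip_commute[of g b] by auto
  then show ?thesis using assms by (simp add: ip_simps)
qed

text \<open>\<open>W\<close> carries the inner product pulled back along \<open>T\<close>, definite
  because \<open>T\<close> is injective. The vector representing the functional
  \<open>ip g (T u)\<close> of \<open>u\<close> in it solves the normal equation, and Pythagoras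
  shows that it strictly beats every other competitor.\<close>

lemma least_squares_unique_minimizer:
  assumes U: "vectorspace (scalars F) U" and W: "subspace (scalars F) W U"
    and fd: "vectorspace.fin_dim (scalars F) (U\<lparr>carrier := W\<rparr>)"
    and T: "T \<in> W \<rightarrow> carrier V" "inj_on T W"
    and T_add: "\<And>u w. u \<in> W \<Longrightarrow> w \<in> W \<Longrightarrow> T (u \<oplus>\<^bsub>U\<^esub> w) = T u \<oplus>\<^bsub>V\<^esub> T w"
    and T_smult: "\<And>c u. c \<in> F \<Longrightarrow> u \<in> W \<Longrightarrow> T (c \<odot>\<^bsub>U\<^esub> u) = c \<odot>\<^bsub>V\<^esub> T u"
    and g: "g \<in> carrier V"
  shows "\<exists>!u. is_arg_min (\<lambda>u. Re (ip (T u \<ominus>\<^bsub>V\<^esub> g) (T u \<ominus>\<^bsub>V\<^esub> g))) (\<lambda>u. u \<in> W) u"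
proof -
  interpret U: vectorspace "scalars F" U by (rule U)
  note Wsub = U.is_module[OF W]
  have Tc: "T u \<in> carrier V" if "u \<in> W" for u using T that by auto
  have W0: "\<zero>\<^bsub>U\<^esub> \<in> W" by (rule submodule.zero_closed[OF Wsub])
  \<comment> \<open>Homogeneity with the scalar 0; definiteness of the pulled-back form rests on
    this.\<close>
  have T0: "T \<zero>\<^bsub>U\<^esub> = \<zero>\<^bsub>V\<^esub>"
    using T_smult[OF F_closed(1) W0] Tc[OF W0] W0 submodule.subset[OF Wsub]
      U.lmult_0[of "\<zero>\<^bsub>U\<^esub>"] lmult_0[of "T \<zero>\<^bsub>U\<^esub>"] by simp
  have inj: "T u = T w \<Longrightarrow> u = w" if "u \<in> W" "w \<in> W" for u w
    using T(2) that by (auto dest: inj_onD)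
  interpret W: inner_product_space F "U\<lparr>carrier := W\<rparr>" "\<lambda>u w. ip (T u) (T w)"
    unfolding inner_product_space_def inner_product_space_axioms_def
  proof (intro conjI allI impI)
    show "vectorspace (scalars F) (U\<lparr>carrier := W\<rparr>)" by (rule U.subspace_is_vs[OF W])
    show "F \<in> {\<real>, UNIV}" by (rule F)
    show "ip (T y) (T x) = cnj (ip (T x) (T y))"
      if "x \<in> carrier (U\<lparr>carrier := W\<rparr>)" "y \<in> carrier (U\<lparr>carrier := W\<rparr>)" for x y
      using that ip_commute[of "T x" "T y"] Tc by simp
    show "0 < Re (ip (T x) (T x))"
      if "x \<in> carrier (U\<lparr>carrier := W\<rparr>)" "x \<noteq> \<zero>\<^bsub>U\<lparr>carrier := W\<rparr>\<^esub>" for x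
      using that Tc inj[of x "\<zero>\<^bsub>U\<^esub>"] T0 W0 by (intro ip_pos) auto
  qed (use Tc T_add T_smult in \<open>auto simp: ip_closed ip_add_left ip_smult_left\<close>)
  have "antilinear F (U\<lparr>carrier := W\<rparr>) (\<lambda>u. ip g (T u))"
    using Tc T_add T_smult g by (auto simp: antilinear_def ip_closed ip_simps)
  \<comment> \<open>\<open>T m\<close> is the orthogonal projection of \<open>g\<close> onto the
    image of \<open>W\<close>.\<close>
  then obtain m where m: "m \<in> W" "\<And>u. u \<in> W \<Longrightarrow> ip (T m) (T u) = ip g (T u)"
    using W.fin_dim_riesz[OF fd] by auto
  define J where "J u = Re (ip (T u \<ominus>\<^bsub>V\<^esub> g) (T u \<ominus>\<^bsub>V\<^esub> g))" for u
  have J: "J u = J m + Re (ip (T u \<ominus>\<^bsub>V\<^esub> T m) (T u \<ominus>\<^bsub>V\<^esub> T m))" if "u \<in> W" for u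
    unfolding J_def using m that Tc g by (intro ip_sub_sub_eq) auto
  have J_ge: "J m \<le> J u" if "u \<in> W" for u
    using J[OF that] ip_self_nonneg[of "T u \<ominus>\<^bsub>V\<^esub> T m"] Tc that m(1) by simp
  have J_eq: "u = m" if "u \<in> W" "J u \<le> J m" for u
  proof (rule inj[OF that(1) m(1)])
    have "T u \<ominus>\<^bsub>V\<^esub> T m = \<zero>\<^bsub>V\<^esub>"
      using J[OF that(1)] that Tc m(1) by (intro ip_self_eq_0) auto
    then show "T u = T m" using Tc that(1) m(1) by simp
  qed
  have "is_arg_min J (\<lambda>u. u \<in> W) m" using m(1) J_ge by (auto simp: is_arg_min_linorder)
  moreover have "u = m" if "is_arg_min J (\<lambda>u. u \<in> W) u" for u
    using that J_eq m(1) by (auto simp: is_arg_min_linorder)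
  ultimately have "\<exists>!u. is_arg_min J (\<lambda>u. u \<in> W) u" by blast
  then show ?thesis unfolding J_def[abs_def] .
qed


section \<open>Coordinates and Gram matrices\<close>

lemma ip_lincomb_left:
  assumes "finite S" "S \<subseteq> carrier V" "a \<in> S \<rightarrow> F" "y \<in> carrier V"
  shows "ip (lincomb a S) y = (\<Sum>v\<in>S. a v * ip v y)"
  using assms
proof (induction S rule: finite_induct)
  case empty
  then show ?case by (simp add: lincomb_def)
next
  case (insert b S)
  have "lincomb a (insert b S) = a b \<odot>\<^bsub>V\<^esub> b \<oplus>\<^bsub>V\<^esub> lincomb a S"
    using lincomb_insert[of S a b] insert by simp
  moreover have "lincomb a S \<in> carrier V" using insert.prems by (intro lincomb_closed) auto
  ultimately show ?case using insert by (simp add: ip_add_left ip_smult_left Pi_iff)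
qed

text \<open>The expansion in the basis is recorded only through inner products and indexed by list
  positions, the shape in which the entries of a matrix product appear.\<close>

lemma basis_coordinates:
  assumes "distinct bs" "basis (set bs)" "x \<in> carrier V"
  obtains c where "\<And>y. y \<in> carrier V \<Longrightarrow> ip x y = (\<Sum>i<length bs. c i * ip (bs ! i) y)"
proof -
  have bs: "set bs \<subseteq> carrier V" "span (set bs) = carrier V" using assms(2) by (auto simp: basis_def)
  obtain a where a: "a \<in> set bs \<rightarrow> F" "lincomb a (set bs) = x"
    using finite_in_span[of "set bs" x] bs assms(3) by auto
  have "ip x y = (\<Sum>i<length bs. a (bs ! i) * ip (bs ! i) y)" if "y \<in> carrier V" for y
  proof -
    have "ip x y = (\<Sum>v\<in>set bs. a v * ip v y)"
      using ip_lincomb_left[OF _ bs(1) a(1) that] a(2) by simp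
    also have "\<dots> = (\<Sum>i<length bs. a (bs ! i) * ip (bs ! i) y)"
      by (rule sum.reindex_bij_betw[OF bij_betw_nth, symmetric]) (use assms(1) in auto)
    finally show ?thesis .
  qed
  then show thesis by (rule that)
qed

text \<open>The transposed order of the indices fits a form linear in its first argument: applied to
  the coordinates of \<open>x\<close>, the matrix returns the products
  \<open>ip x (bs ! i)\<close>.\<close>

definition gram_matrix :: "'v list \<Rightarrow> complex mat" where
  "gram_matrix bs = mat (length bs) (length bs) (\<lambda>(i, j). ip (bs ! j) (bs ! i))"

lemma gram_matrix_carrier: "gram_matrix bs \<in> carrier_mat (length bs) (length bs)"
  by (simp add: gram_matrix_def)

lemma gram_matrix_mult:
  assumes "\<And>i j. i < length bs \<Longrightarrow> j < n \<Longrightarrow>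
      ip (x j) (bs ! i) = (\<Sum>k<length bs. c j k * ip (bs ! k) (bs ! i))"
  shows "gram_matrix bs * mat (length bs) n (\<lambda>(k, j). c j k) =
         mat (length bs) n (\<lambda>(i, j). ip (x j) (bs ! i))"
  by (rule eq_matI)
    (auto simp: gram_matrix_def scalar_prod_def assms atLeast0LessThan mult.commute intro!: sum.cong)

text \<open>Interpolation provides a family \<open>w\<close> dual to the basis. Its coordinates are
  the columns of a right inverse, and for square matrices a right inverse is two-sided.\<close>

lemma gram_matrix_invertible:
  assumes "distinct bs" "basis (set bs)"
  obtains Ginv where "mat_inverse (gram_matrix bs) = Some Ginv"
proof -
  let ?M = "length bs"
  have bs: "set bs \<subseteq> carrier V" "lin_indpt (set bs)" using assms(2) by (auto simp: basis_def)
  have "\<exists>w\<in>carrier V. \<forall>a\<in>set bs. ip w a = (if a = bs ! k then 1 else 0)" for k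
    using interpolation[OF _ bs, of "\<lambda>a. if a = bs ! k then 1 else 0"] F_closed
      span_is_subset2[OF bs(1)] by fastforce
  then obtain w where w: "\<And>k. w k \<in> carrier V"
      "\<And>k a. a \<in> set bs \<Longrightarrow> ip (w k) a = (if a = bs ! k then 1 else 0)"
    by metis
  have "\<exists>c. \<forall>y\<in>carrier V. ip (w k) y = (\<Sum>i<?M. c i * ip (bs ! i) y)" for k
    using basis_coordinates[OF assms w(1)] by metis
  then obtain c where c: "\<And>k y. y \<in> carrier V \<Longrightarrow> ip (w k) y = (\<Sum>i<?M. c k i * ip (bs ! i) y)"
    by metis
  let ?X = "mat ?M ?M (\<lambda>(j, k). c k j)"
  have "gram_matrix bs * ?X = mat ?M ?M (\<lambda>(i, j). ip (w j) (bs ! i))"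
    by (rule gram_matrix_mult) (use bs in \<open>auto intro!: c\<close>)
  also have "\<dots> = 1\<^sub>m ?M"
    using assms(1) by (intro eq_matI) (auto simp: w(2) nth_eq_iff_index_eq)
  finally have GX: "gram_matrix bs * ?X = 1\<^sub>m ?M" .
  then have "?X * gram_matrix bs = 1\<^sub>m ?M"
    by (intro mat_mult_left_right_inverse[OF gram_matrix_carrier]) auto
  \<comment> \<open>\<open>mat_inverse\<close> yields \<open>None\<close> only for matrices that are
    not units of the matrix ring.\<close>
  then have "gram_matrix bs \<in> Units (ring_mat TYPE(complex) ?M ())"
    using GX gram_matrix_carrier by (auto simp: Units_def ring_mat_def intro!: bexI[of _ ?X])
  then have "mat_inverse (gram_matrix bs) \<noteq> None"
    using mat_inverse(1)[OF gram_matrix_carrier, where b = "()"] by (intro notI) simp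
  then show thesis using that by auto
qed

lemma adjoint_gram_inverse_mult:
  assumes bs: "distinct bs" "basis (set bs)" and x: "\<And>j. j < n \<Longrightarrow> x j \<in> carrier V"
    and inv: "mat_inverse (gram_matrix bs) = Some Ginv"
    and B: "B = mat (length bs) n (\<lambda>(i, j). ip (x j) (bs ! i))"
  shows "mat_adjoint B * Ginv * B = mat n n (\<lambda>(i, j). ip (x j) (x i))"
proof -
  let ?M = "length bs"
  have bsc: "bs ! i \<in> carrier V" if "i < ?M" for i using bs(2) that by (auto simp: basis_def)
  \<comment> \<open>The guard \<open>j < n\<close> sits inside the existential so that the statement
    holds for every \<open>j\<close> and choice gives a total family of coordinates.\<close>
  have "\<exists>c. \<forall>y\<in>carrier V. j < n \<longrightarrow> ip (x j) y = (\<Sum>i<?M. c i * ip (bs ! i) y)" for j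
  proof (cases "j < n")
    case True
    then show ?thesis using basis_coordinates[OF bs x[OF True]] by metis
  qed simp
  then obtain c where c: "\<And>j y. y \<in> carrier V \<Longrightarrow> j < n \<Longrightarrow>
      ip (x j) y = (\<Sum>i<?M. c j i * ip (bs ! i) y)"
    by metis
  define Y where "Y = mat ?M n (\<lambda>(k, j). c j k)"
  have GY: "gram_matrix bs * Y = B"
    unfolding Y_def B by (rule gram_matrix_mult) (use bsc in \<open>auto intro!: c\<close>)
  note G = mat_inverse(2)[OF gram_matrix_carrier inv]
  have Bc: "B \<in> carrier_mat ?M n" and Yc: "Y \<in> carrier_mat ?M n" by (simp_all add: B Y_def)
  have adj: "mat_adjoint B \<in> carrier_mat n ?M"
    using mat_of_rows_carrier(1)[of "dim_row B" "map conjugate (cols B)"] Bc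
    by (simp add: mat_adjoint_def)
  have "Ginv * B = Ginv * gram_matrix bs * Y"
    unfolding GY[symmetric] using G Yc gram_matrix_carrier
    by (intro assoc_mult_mat[symmetric]) auto
  also have "\<dots> = Y" using G Yc by simp
  finally have "mat_adjoint B * Ginv * B = mat_adjoint B * Y"
    using assoc_mult_mat[OF adj _ Bc, of Ginv] G by simp
  also have "\<dots> = mat n n (\<lambda>(i, j). ip (x j) (x i))"
  proof (rule eq_matI)
    fix i j assume "i < dim_row (mat n n (\<lambda>(i, j). ip (x j) (x i)))"
      "j < dim_col (mat n n (\<lambda>(i, j). ip (x j) (x i)))"
    then have ij: "i < n" "j < n" by auto
    have "(mat_adjoint B * Y) $$ (i, j) = (\<Sum>k<?M. cnj (ip (x i) (bs ! k)) * c j k)"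
      using ij adj Yc Bc
      by (auto simp: scalar_prod_def mat_adjoint_def mat_of_rows_def B Y_def
          conjugate_complex_def atLeast0LessThan intro!: sum.cong)
    \<comment> \<open>The conjugation in the adjoint swaps the arguments of the form, which leaves
      the expansion of \<open>x j\<close> paired with \<open>x i\<close>.\<close>
    also have "\<dots> = (\<Sum>k<?M. c j k * ip (bs ! k) (x i))"
      using ij ip_commute[OF x bsc] by (intro sum.cong) auto
    also have "\<dots> = ip (x j) (x i)" using c ij x by simp
    finally show "(mat_adjoint B * Y) $$ (i, j) = mat n n (\<lambda>(i, j). ip (x j) (x i)) $$ (i, j)"
      using ij by simp
  qed (use adj Yc in auto)
  finally show ?thesis .
qed

end

section \<open>Induced norm and dual norm\<close>

text \<open>The form is tied to the record field because \<open>ip_norm\<close> and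
  \<open>dual_norm\<close> read it from there.\<close>

locale inner_product_record = inner_product_space F V "iprod V"
  for F :: "complex set" and V :: "'v ip_space"
begin

lemma ip_norm_sq: "x \<in> carrier V \<Longrightarrow> (ip_norm V x)\<^sup>2 = Re (iprod V x x)"
  by (simp add: ip_norm_def ip_self_nonneg)

lemma ip_norm_nonneg: "x \<in> carrier V \<Longrightarrow> ip_norm V x \<ge> 0"
  by (simp add: ip_norm_def ip_self_nonneg)

lemma ip_norm_eq_0: "x \<in> carrier V \<Longrightarrow> ip_norm V x = 0 \<Longrightarrow> x = \<zero>\<^bsub>V\<^esub>"
  by (simp add: ip_norm_def ip_self_eq_0)

lemma ip_norm_zero [simp]: "ip_norm V \<zero>\<^bsub>V\<^esub> = 0"
  by (simp add: ip_norm_def)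

lemma ip_self_eq_norm: "x \<in> carrier V \<Longrightarrow> iprod V x x = of_real ((ip_norm V x)\<^sup>2)"
  using ip_self_real by (simp add: ip_norm_sq)

lemma ip_norm_smult:
  assumes "c \<in> F" "x \<in> carrier V"
  shows "ip_norm V (c \<odot>\<^bsub>V\<^esub> x) = cmod c * ip_norm V x"
proof (rule power2_eq_imp_eq)
  have "c * cnj c * iprod V x x = of_real ((cmod c)\<^sup>2 * (ip_norm V x)\<^sup>2)"
    using assms by (simp add: ip_self_eq_norm flip: complex_norm_square)
  then have "Re (iprod V (c \<odot>\<^bsub>V\<^esub> x) (c \<odot>\<^bsub>V\<^esub> x)) = (cmod c)\<^sup>2 * (ip_norm V x)\<^sup>2"
    using assms by (simp add: ip_simps mult.assoc [symmetric] mult.commute[of "cnj c"] del: of_real_mult)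
  then show "(ip_norm V (c \<odot>\<^bsub>V\<^esub> x))\<^sup>2 = (cmod c * ip_norm V x)\<^sup>2"
    using assms by (simp add: ip_norm_sq power_mult_distrib)
qed (use assms in \<open>auto simp: ip_norm_nonneg\<close>)

lemma ip_norm_add_orthogonal:
  assumes "x \<in> carrier V" "y \<in> carrier V" "iprod V x y = 0"
  shows "(ip_norm V (x \<oplus>\<^bsub>V\<^esub> y))\<^sup>2 = (ip_norm V x)\<^sup>2 + (ip_norm V y)\<^sup>2"
  using assms ip_commute[of x y] by (simp add: ip_norm_sq ip_simps)

text \<open>\<open>a \<odot> w\<close> is the projection of \<open>v\<close> onto the line through
  \<open>w\<close>. This is the source of the Cauchy-Schwarz bound below, and it splits the test
  vectors of the dual norm.\<close>

lemma orthogonal_decomposition: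
  assumes w: "w \<in> carrier V" and v: "v \<in> carrier V"
  obtains a z where "a \<in> F" "z \<in> carrier V" "iprod V w z = 0" "v = a \<odot>\<^bsub>V\<^esub> w \<oplus>\<^bsub>V\<^esub> z"
    "(ip_norm V v)\<^sup>2 = (cmod a * ip_norm V w)\<^sup>2 + (ip_norm V z)\<^sup>2"
proof -
  \<comment> \<open>For \<open>w = 0\<close> this is \<open>a = 0\<close>, as \<open>x / 0 = 0\<close>.\<close>
  define a where "a = iprod V v w / iprod V w w"
  define z where "z = v \<ominus>\<^bsub>V\<^esub> a \<odot>\<^bsub>V\<^esub> w"
  have a: "a \<in> F" using ip_closed[OF v w] ip_closed[OF w w] by (simp add: a_def F_closed)
  then have z: "z \<in> carrier V" using v w by (simp add: z_def)
  have "iprod V z w = 0"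
  proof (cases "w = \<zero>\<^bsub>V\<^esub>")
    case False
    then have "iprod V w w \<noteq> 0" using ip_pos[OF w] by auto
    then show ?thesis using a v w by (simp add: z_def ip_simps a_def)
  qed (use z in auto)
  then have wz: "iprod V w z = 0" using ip_commute[OF z w] by simp
  have eq: "v = a \<odot>\<^bsub>V\<^esub> w \<oplus>\<^bsub>V\<^esub> z"
    by (rule ip_left_cancel) (use a v w z in \<open>auto simp: z_def ip_simps\<close>)
  have "(ip_norm V v)\<^sup>2 = (cmod a * ip_norm V w)\<^sup>2 + (ip_norm V z)\<^sup>2"
    using ip_norm_add_orthogonal[of "a \<odot>\<^bsub>V\<^esub> w" z] eq a w z wz ip_norm_smult[OF a w]
    by (simp add: ip_smult_left)
  with a z wz eq show thesis by (rule that)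
qed

text \<open>The conditions for membership in the antidual apart from extensionality, so that
  functionals written as plain lambda terms qualify.\<close>

definition bounded_antilinear :: "('v \<Rightarrow> complex) \<Rightarrow> bool" where
  "bounded_antilinear f \<longleftrightarrow>
     antilinear F V f \<and> (\<exists>C. \<forall>x\<in>carrier V. cmod (f x) \<le> C * ip_norm V x)"

text \<open>A supremum of reals is meaningful only for sets bounded above; this is the side
  condition of each \<open>cSUP_upper\<close> below.\<close>

lemma dual_norm_bdd_above:
  assumes "bounded_antilinear f"
  shows "bdd_above ((\<lambda>v. cmod (f v)) ` {v \<in> carrier V. ip_norm V v \<le> 1})"
proof -
  obtain C where C: "\<And>x. x \<in> carrier V \<Longrightarrow> cmod (f x) \<le> C * ip_norm V x"
    using assms by (auto simp: bounded_antilinear_def)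
  show ?thesis
  proof (rule bdd_aboveI2)
    fix v assume "v \<in> {v \<in> carrier V. ip_norm V v \<le> 1}"
    then have v: "v \<in> carrier V" "ip_norm V v \<le> 1" by auto
    \<comment> \<open>On the trivial space \<open>C\<close> may be negative, hence the absolute
      value.\<close>
    have "C * ip_norm V v \<le> \<bar>C\<bar> * 1" using v ip_norm_nonneg by (intro mult_mono) auto
    then show "cmod (f v) \<le> \<bar>C\<bar>" using C[OF v(1)] by simp
  qed
qed

text \<open>Scale \<open>x\<close> to norm one. At the zero vector the boundedness constant forces
  \<open>f\<close> to vanish.\<close>

lemma dual_norm_upper:
  assumes f: "bounded_antilinear f" and x: "x \<in> carrier V"
  shows "cmod (f x) \<le> dual_norm V f * ip_norm V x"
proof (cases "x = \<zero>\<^bsub>V\<^esub>")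
  case True
  then have "ip_norm V x = 0" by simp
  moreover have "\<exists>C. \<forall>x\<in>carrier V. cmod (f x) \<le> C * ip_norm V x"
    using f by (simp add: bounded_antilinear_def)
  ultimately show ?thesis using x by fastforce
next
  case False
  let ?n = "ip_norm V x" and ?c = "complex_of_real (1 / ip_norm V x)"
  have n: "?n > 0" using False ip_norm_eq_0[OF x] ip_norm_nonneg[OF x] by force
  have "cmod (f (?c \<odot>\<^bsub>V\<^esub> x)) \<le> dual_norm V f"
    unfolding dual_norm_def
    using n x F_closed(8)[of "1 / ?n"] ip_norm_smult[OF F_closed(8) x, of "1 / ?n"]
    by (intro cSUP_upper dual_norm_bdd_above f) (auto simp: norm_divide)
  moreover have "f (?c \<odot>\<^bsub>V\<^esub> x) = cnj ?c * f x"
    using f x F_closed(8)[of "1 / ?n"] unfolding bounded_antilinear_def antilinear_def by blast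
  ultimately have "cmod (cnj ?c) * cmod (f x) \<le> dual_norm V f" by (simp only: norm_mult)
  then show ?thesis using n by (simp add: norm_divide divide_le_eq)
qed

lemma dual_norm_least:
  assumes "\<And>x. x \<in> carrier V \<Longrightarrow> ip_norm V x \<le> 1 \<Longrightarrow> cmod (f x) \<le> K"
  shows "dual_norm V f \<le> K"
proof -
  have "\<zero>\<^bsub>V\<^esub> \<in> {v \<in> carrier V. ip_norm V v \<le> 1}" by simp
  then show ?thesis unfolding dual_norm_def using assms by (intro cSUP_least) auto
qed

lemma dual_norm_nonneg:
  assumes "bounded_antilinear f"
  shows "0 \<le> dual_norm V f"
proof -
  have "cmod (f \<zero>\<^bsub>V\<^esub>) \<le> dual_norm V f"
    unfolding dual_norm_def by (intro cSUP_upper dual_norm_bdd_above assms) auto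
  then show ?thesis using norm_ge_zero order_trans by blast
qed

lemma bounded_antilinear_ip_diff:
  assumes w: "w \<in> carrier V" and f: "bounded_antilinear f"
    and h: "\<And>v. v \<in> carrier V \<Longrightarrow> h v = iprod V w v - f v"
  shows "bounded_antilinear h"
proof -
  have "cmod (h v) \<le> (ip_norm V w + dual_norm V f) * ip_norm V v" if v: "v \<in> carrier V" for v
  proof -
    obtain a z where d: "a \<in> F" "z \<in> carrier V" "iprod V w z = 0" "v = a \<odot>\<^bsub>V\<^esub> w \<oplus>\<^bsub>V\<^esub> z"
        "(ip_norm V v)\<^sup>2 = (cmod a * ip_norm V w)\<^sup>2 + (ip_norm V z)\<^sup>2"
      by (rule orthogonal_decomposition[OF w v])
    have "cmod a * ip_norm V w \<le> ip_norm V v"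
      by (rule power2_le_imp_le) (use d v in \<open>auto simp: ip_norm_nonneg\<close>)
    \<comment> \<open>Only the component of \<open>v\<close> along \<open>w\<close> contributes;
      with the previous bound this is Cauchy-Schwarz for \<open>w\<close> and
      \<open>v\<close>.\<close>
    moreover have "cmod (iprod V w v) = ip_norm V w * (cmod a * ip_norm V w)"
      using w d(1-4)
      by (simp add: ip_simps ip_self_eq_norm norm_mult norm_power power2_eq_square ip_norm_nonneg)
    ultimately have "cmod (iprod V w v) \<le> ip_norm V w * ip_norm V v"
      using w by (simp add: mult_left_mono ip_norm_nonneg)
    moreover have "cmod (h v) \<le> cmod (iprod V w v) + cmod (f v)"
      using h[OF v] norm_triangle_ineq4 by simp
    ultimately show ?thesis using dual_norm_upper[OF f v] by (simp add: distrib_right)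
  qed
  moreover have "antilinear F V h"
    using antilinear_ip[OF w] f
    by (auto simp: antilinear_def bounded_antilinear_def h F_closed(4) Pi_iff algebra_simps)
  ultimately show ?thesis by (auto simp: bounded_antilinear_def)
qed

text \<open>
  For the lower bound, the functional is tested with \<open>w - f(z) \<odot> z\<close>, where \<open>z \<bottom> w\<close> and \<open>\<parallel>z\<parallel> \<le> 1\<close>.
\<close>

lemma dual_norm_pythagoras:
  assumes w: "w \<in> carrier V" and f: "bounded_antilinear f" and fw: "f w = 0"
    and h: "\<And>v. v \<in> carrier V \<Longrightarrow> h v = iprod V w v - f v"
  shows "(dual_norm V h)\<^sup>2 = (ip_norm V w)\<^sup>2 + (dual_norm V f)\<^sup>2"
proof (rule antisym)
  let ?w = "ip_norm V w" and ?D = "dual_norm V f" and ?H = "dual_norm V h"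
  note hb = bounded_antilinear_ip_diff[OF w f h]
  have f_add: "f (x \<oplus>\<^bsub>V\<^esub> y) = f x + f y" if "x \<in> carrier V" "y \<in> carrier V" for x y
    using f that by (simp add: bounded_antilinear_def antilinear_def)
  have f_smult: "f (c \<odot>\<^bsub>V\<^esub> x) = cnj c * f x" if "c \<in> F" "x \<in> carrier V" for c x
    using f that by (simp add: bounded_antilinear_def antilinear_def)
  have "?H \<le> sqrt (?w\<^sup>2 + ?D\<^sup>2)"
  proof (rule dual_norm_least)
    fix v assume v: "v \<in> carrier V" "ip_norm V v \<le> 1"
    obtain a z where d: "a \<in> F" "z \<in> carrier V" "iprod V w z = 0" "v = a \<odot>\<^bsub>V\<^esub> w \<oplus>\<^bsub>V\<^esub> z"
        "(ip_norm V v)\<^sup>2 = (cmod a * ?w)\<^sup>2 + (ip_norm V z)\<^sup>2"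
      by (rule orthogonal_decomposition[OF w v(1)])
    let ?a = "cmod a * ?w" and ?z = "ip_norm V z"
    \<comment> \<open>The mixed terms vanish: \<open>z\<close> is orthogonal to \<open>w\<close>,
      and \<open>f w = 0\<close>.\<close>
    have "h v = cnj a * of_real (?w\<^sup>2) - f z"
      using w d(1-4) v(1) by (simp add: h ip_simps ip_self_eq_norm f_add f_smult fw)
    then have "cmod (h v) \<le> cmod (cnj a * of_real (?w\<^sup>2)) + cmod (f z)"
      by (simp add: norm_triangle_ineq4)
    also have "\<dots> \<le> ?a * ?w + ?z * ?D"
      using dual_norm_upper[OF f d(2)] by (simp add: norm_mult norm_power power2_eq_square mult_ac)
    \<comment> \<open>Cauchy-Schwarz in the plane for \<open>(?a, ?z)\<close> and
      \<open>(?w, ?D)\<close>, where the first vector has length at most one; the defect is the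
      square of \<open>?a * ?D - ?z * ?w\<close>.\<close>
    also have "\<dots> \<le> sqrt ((?w\<^sup>2 + ?D\<^sup>2) * 1)"
    proof (rule real_le_rsqrt)
      have "(?a * ?w + ?z * ?D)\<^sup>2 \<le> (?w\<^sup>2 + ?D\<^sup>2) * (?a\<^sup>2 + ?z\<^sup>2)"
        using zero_le_power2[of "?a * ?D - ?z * ?w"] by (simp add: power2_eq_square algebra_simps)
      also have "?a\<^sup>2 + ?z\<^sup>2 \<le> 1"
        using v d(5) by (metis ip_norm_nonneg power_le_one)
      finally show "(?a * ?w + ?z * ?D)\<^sup>2 \<le> (?w\<^sup>2 + ?D\<^sup>2) * 1"
        by (simp add: mult_left_mono)
    qed
    finally show "cmod (h v) \<le> sqrt (?w\<^sup>2 + ?D\<^sup>2)" by simp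
  qed
  then have "?H\<^sup>2 \<le> (sqrt (?w\<^sup>2 + ?D\<^sup>2))\<^sup>2"
    by (intro power_mono dual_norm_nonneg[OF hb])
  then show "?H\<^sup>2 \<le> ?w\<^sup>2 + ?D\<^sup>2" by simp

  have test: "?w\<^sup>2 + (cmod (f z))\<^sup>2 \<le> ?H\<^sup>2"
    if z: "z \<in> carrier V" "iprod V w z = 0" "ip_norm V z \<le> 1" for z
  proof -
    let ?q = "f z" and ?s = "?w\<^sup>2 + (cmod (f z))\<^sup>2"
    have q: "- ?q \<in> F" using f z F_closed(7) by (auto simp: bounded_antilinear_def antilinear_def)
    define v where "v = w \<oplus>\<^bsub>V\<^esub> (- ?q) \<odot>\<^bsub>V\<^esub> z"
    have v: "v \<in> carrier V" using w z q by (simp add: v_def)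
    have "h v = iprod V w w + cnj ?q * ?q"
      using w z q v f_add[of w "(- ?q) \<odot>\<^bsub>V\<^esub> z"] f_smult[OF q z(1)]
      by (simp add: h ip_simps fw v_def)
    also have "\<dots> = of_real ?s"
      using w by (simp add: ip_self_eq_norm mult.commute flip: complex_norm_square)
    finally have hv: "cmod (h v) = ?s" by (simp only: norm_of_real) simp
    have "(ip_norm V v)\<^sup>2 = ?w\<^sup>2 + (cmod ?q * ip_norm V z)\<^sup>2"
      using ip_norm_add_orthogonal[of w "(- ?q) \<odot>\<^bsub>V\<^esub> z"] w z q ip_norm_smult[OF q z(1)]
      by (simp add: v_def ip_smult_right)
    moreover have "(cmod ?q * ip_norm V z)\<^sup>2 \<le> (cmod ?q * 1)\<^sup>2"
      using z by (intro power_mono mult_left_mono) (auto simp: ip_norm_nonneg)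
    ultimately have nv: "(ip_norm V v)\<^sup>2 \<le> ?s" by simp
    have "?s\<^sup>2 \<le> (?H * ip_norm V v)\<^sup>2"
      using dual_norm_upper[OF hb v] unfolding hv by (intro power_mono) auto
    also have "\<dots> \<le> ?H\<^sup>2 * ?s" using nv by (simp add: power_mult_distrib mult_left_mono)
    \<comment> \<open>The value \<open>?s\<close> of \<open>h\<close> at \<open>v\<close> also
      bounds the squared norm of \<open>v\<close>, so one factor \<open>?s\<close> cancels; for
      vanishing \<open>?s\<close> the claim is trivial.\<close>
    finally have "?s * ?s \<le> ?H\<^sup>2 * ?s" by (simp add: power2_eq_square)
    then show ?thesis by (cases "?s > 0") (auto simp: not_less intro: order_trans)
  qed
  \<comment> \<open>Testing with \<open>z = 0\<close>. This makes the radicand below nonnegative, so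
    that the root can be squared away.\<close>
  have w_le: "?w\<^sup>2 \<le> ?H\<^sup>2"
    using test[of "\<zero>\<^bsub>V\<^esub>"] w by (auto intro: order_trans[rotated])
  have "?D \<le> sqrt (?H\<^sup>2 - ?w\<^sup>2)"
  proof (rule dual_norm_least)
    fix v assume v: "v \<in> carrier V" "ip_norm V v \<le> 1"
    obtain a z where d: "a \<in> F" "z \<in> carrier V" "iprod V w z = 0" "v = a \<odot>\<^bsub>V\<^esub> w \<oplus>\<^bsub>V\<^esub> z"
        "(ip_norm V v)\<^sup>2 = (cmod a * ?w)\<^sup>2 + (ip_norm V z)\<^sup>2"
      by (rule orthogonal_decomposition[OF w v(1)])
    \<comment> \<open>Dropping the component along \<open>w\<close> keeps the value of
      \<open>f\<close>, as \<open>f w = 0\<close>, and does not increase the norm, so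
      \<open>z\<close> is admissible in \<open>test\<close>.\<close>
    have "ip_norm V z \<le> ip_norm V v"
      by (rule power2_le_imp_le) (use d(5) v in \<open>auto simp: ip_norm_nonneg\<close>)
    then have "?w\<^sup>2 + (cmod (f z))\<^sup>2 \<le> ?H\<^sup>2" using test[OF d(2,3)] v by simp
    moreover have "f v = f z" using d(1,2,4) w by (simp add: f_add f_smult fw)
    ultimately show "cmod (f v) \<le> sqrt (?H\<^sup>2 - ?w\<^sup>2)" by (intro real_le_rsqrt) simp
  qed
  then have "?D\<^sup>2 \<le> (sqrt (?H\<^sup>2 - ?w\<^sup>2))\<^sup>2" by (intro power_mono dual_norm_nonneg[OF f])
  then show "?w\<^sup>2 + ?D\<^sup>2 \<le> ?H\<^sup>2" using w_le by simp
qed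

end


section \<open>Hilbert spaces and subtraction in the antidual\<close>

lemma hilbert_space_inner_product_record:
  assumes "F \<in> {\<real>, UNIV}" "hilbert_space F V"
  shows "inner_product_record F V"
  unfolding inner_product_record_def inner_product_space_def inner_product_space_axioms_def
proof (intro conjI allI impI)
  show "iprod V y x = cnj (iprod V x y)" if "x \<in> carrier V" "y \<in> carrier V" for x y
    using assms(2) that unfolding hilbert_space_def by blast
qed (use assms(1) assms(2)[unfolded hilbert_space_def] in \<open>blast+\<close>)

text \<open>The additive inverse is a definite description. It is identified as the pointwise
  negative; its uniqueness rests on functionals being \<open>undefined\<close> off the
  carrier.\<close>

lemma dual_space_minus_apply:
  assumes F: "F \<in> {\<real>, UNIV}" and V: "inner_product_record F V"
    and l: "l \<in> carrier (dual_space F V)" and v: "v \<in> carrier V"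
  shows "(f \<ominus>\<^bsub>dual_space F V\<^esub> l) v = f v - l v"
proof -
  interpret inner_product_record F V by (rule V)
  let ?m = "\<lambda>v\<in>carrier V. - l v"
  have "- l v \<in> F" if "v \<in> carrier V" for v
    using l that by (intro F_closed(7)) (auto simp: dual_space_def)
  then have "?m \<in> carrier (dual_space F V)"
    using l by (auto simp: dual_space_def)
  then have "\<ominus>\<^bsub>dual_space F V\<^esub> l = ?m"
    unfolding a_inv_def m_inv_def
  proof (intro the_equality)
    fix y assume y: "y \<in> carrier (add_monoid (dual_space F V)) \<and>
        l \<otimes>\<^bsub>add_monoid (dual_space F V)\<^esub> y = \<one>\<^bsub>add_monoid (dual_space F V)\<^esub> \<and>
        y \<otimes>\<^bsub>add_monoid (dual_space F V)\<^esub> l = \<one>\<^bsub>add_monoid (dual_space F V)\<^esub>"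
    then have "y \<in> carrier V \<rightarrow>\<^sub>E F" and sum: "(\<lambda>v\<in>carrier V. l v + y v) = (\<lambda>v\<in>carrier V. 0)"
      by (auto simp: dual_space_def)
    moreover have "y v = - l v" if "v \<in> carrier V" for v
      using fun_cong[OF sum, of v] that by (simp add: add_eq_0_iff)
    ultimately show "y = ?m" by (intro extensionalityI[of _ "carrier V"]) (auto simp: PiE_def)
  qed (auto simp: dual_space_def fun_eq_iff)
  then show ?thesis using v by (simp add: a_minus_def dual_space_def)
qed

section \<open>The discrete least-squares setting\<close>

context
  fixes F :: "complex set" and U :: "'u ip_space" and V :: "'v ip_space"
    and B :: "'u \<Rightarrow> 'v \<Rightarrow> complex" and Uh :: "'u set" and Vr :: "'v set"
  assumes setting: "discrete_ls_setting F U V B Uh Vr"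
begin

interpretation V: inner_product_record F V
  using setting by (intro hilbert_space_inner_product_record) (auto simp: discrete_ls_setting_def)

text \<open>The inclusion of the image of \<open>Uh\<close> in the Riesz image of \<open>Vr\<close>
  enters here: \<open>T\<close> is \<open>B\<close> followed by the inverse Riesz map, with values
  in \<open>Vr\<close>.\<close>

lemma trial_riesz_representatives:
  obtains T where "T \<in> Uh \<rightarrow> Vr" "\<And>u. u \<in> Uh \<Longrightarrow> B u = riesz V (T u)"
proof -
  have "\<forall>u\<in>Uh. \<exists>w. w \<in> Vr \<and> B u = riesz V w"
    using setting by (auto simp: discrete_ls_setting_def)
  then obtain T where "\<forall>u\<in>Uh. T u \<in> Vr \<and> B u = riesz V (T u)" by (metis (no_types))
  then show thesis using that by blast
qed

lemma riesz_inj: "inj_on (riesz V) (carrier V)"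
proof (rule inj_onI)
  fix x y assume "x \<in> carrier V" "y \<in> carrier V" "riesz V x = riesz V y"
  then show "x = y"
    by (intro V.ip_left_cancel) (auto simp: riesz_def fun_eq_iff restrict_def split: if_splits)
qed

text \<open>\<open>inv_into\<close> finds \<open>d\<close> because the Riesz map of
  \<open>Vr\<close> is injective on \<open>Vr\<close>; the restriction discards what
  \<open>f\<close> does elsewhere.\<close>

lemma discrete_riesz_inv_eq:
  assumes d: "d \<in> Vr" and f: "\<And>v. v \<in> Vr \<Longrightarrow> f v = iprod V d v"
  shows "discrete_riesz_inv V Vr f = d"
proof -
  have Vr: "subspace (scalars F) Vr V"
    using setting by (simp add: discrete_ls_setting_def fin_dim_subspace_def)
  interpret W: inner_product_space F "V\<lparr>carrier := Vr\<rparr>" "iprod V"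
    by (rule V.subspace_inner_product_space[OF Vr])
  have "inj_on (riesz (V\<lparr>carrier := Vr\<rparr>)) Vr"
  proof (rule inj_onI)
    fix x y assume xy: "x \<in> Vr" "y \<in> Vr" "riesz (V\<lparr>carrier := Vr\<rparr>) x = riesz (V\<lparr>carrier := Vr\<rparr>) y"
    have "iprod V x z = iprod V y z" if "z \<in> Vr" for z
      using fun_cong[OF xy(3), of z] that by (simp add: riesz_def)
    then show "x = y" using W.ip_left_cancel[of x y] xy by simp
  qed
  moreover have "restrict f Vr = riesz (V\<lparr>carrier := Vr\<rparr>) d"
    using f by (auto simp: riesz_def restrict_def)
  ultimately show ?thesis using d by (simp add: discrete_riesz_inv_def inv_into_f_f)
qed

lemma minimizers_coincide:
  assumes l: "l \<in> carrier (dual_space F V)"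
  defines "J \<equiv> \<lambda>u. (dual_norm V (B u \<ominus>\<^bsub>dual_space F V\<^esub> l))\<^sup>2"
    and "Jr \<equiv> \<lambda>u. (ip_norm V (discrete_riesz_inv V Vr (B u \<ominus>\<^bsub>dual_space F V\<^esub> l)))\<^sup>2"
  shows "\<exists>!u. is_arg_min J (\<lambda>u. u \<in> Uh) u" "\<exists>!u. is_arg_min Jr (\<lambda>u. u \<in> Uh) u"
    "arg_min J (\<lambda>u. u \<in> Uh) = arg_min Jr (\<lambda>u. u \<in> Uh)"
proof -
  have F: "F \<in> {\<real>, UNIV}" and Vr: "subspace (scalars F) Vr V"
      "vectorspace.fin_dim (scalars F) (V\<lparr>carrier := Vr\<rparr>)"
    and Uh: "subspace (scalars F) Uh U" "vectorspace.fin_dim (scalars F) (U\<lparr>carrier := Uh\<rparr>)"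
    and U: "vectorspace (scalars F) U" and injB: "inj_on B Uh"
    and Bhom: "B \<in> module_hom (scalars F) U (dual_space F V)"
    using setting
    by (auto simp: discrete_ls_setting_def fin_dim_subspace_def hilbert_space_def bounded_linear_op_def)
  have Vrc: "Vr \<subseteq> carrier V" using submodule.subset[OF V.is_module[OF Vr(1)]] .
  note Uhs = vectorspace.is_module[OF U Uh(1)]
  have Uhc: "Uh \<subseteq> carrier U" using submodule.subset[OF Uhs] .
  have lb: "V.bounded_antilinear l"
    using l by (auto simp: V.bounded_antilinear_def antilinear_def dual_space_def)
  obtain g where g: "g \<in> Vr" "\<And>v. v \<in> Vr \<Longrightarrow> iprod V g v = l v"
    using V.riesz_subspace[OF Vr] lb V.bounded_antilinear_def by blast
  have gc: "g \<in> carrier V" using g Vrc by auto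
  obtain T where T: "T \<in> Uh \<rightarrow> Vr" "\<And>u. u \<in> Uh \<Longrightarrow> B u = riesz V (T u)"
    using trial_riesz_representatives by blast
  have Tc: "T u \<in> carrier V" if "u \<in> Uh" for u using T(1) Vrc that by auto
  have B_app: "B u v = iprod V (T u) v" if "u \<in> Uh" "v \<in> carrier V" for u v
    using T(2)[OF that(1)] that(2) by (simp add: riesz_def)
  \<comment> \<open>\<open>T\<close> inherits linearity from \<open>B\<close>, compared through
    inner products with arbitrary \<open>z\<close>.\<close>
  have T_add: "T (u \<oplus>\<^bsub>U\<^esub> w) = T u \<oplus>\<^bsub>V\<^esub> T w" if "u \<in> Uh" "w \<in> Uh" for u w
  proof (rule V.ip_left_cancel)
    fix z assume z: "z \<in> carrier V"
    have uw: "u \<oplus>\<^bsub>U\<^esub> w \<in> Uh" using submodule.m_closed[OF Uhs that] .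
    have "B (u \<oplus>\<^bsub>U\<^esub> w) = B u \<oplus>\<^bsub>dual_space F V\<^esub> B w"
      using module_hom_add[OF Bhom] that Uhc by auto
    then show "iprod V (T (u \<oplus>\<^bsub>U\<^esub> w)) z = iprod V (T u \<oplus>\<^bsub>V\<^esub> T w) z"
      using B_app[OF uw z] B_app[OF that(1) z] B_app[OF that(2) z] z that Tc
      by (simp add: V.ip_add_left dual_space_def)
  qed (use that Tc submodule.m_closed[OF Uhs that] in auto)
  have T_smult: "T (c \<odot>\<^bsub>U\<^esub> u) = c \<odot>\<^bsub>V\<^esub> T u" if "c \<in> F" "u \<in> Uh" for c u
  proof (rule V.ip_left_cancel)
    fix z assume z: "z \<in> carrier V"
    have cu: "c \<odot>\<^bsub>U\<^esub> u \<in> Uh" using submodule.smult_closed[OF Uhs, of c u] that by simp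
    have "B (c \<odot>\<^bsub>U\<^esub> u) = c \<odot>\<^bsub>dual_space F V\<^esub> B u"
      using module_hom_smult[OF Bhom, of c u] that Uhc by auto
    then show "iprod V (T (c \<odot>\<^bsub>U\<^esub> u)) z = iprod V (c \<odot>\<^bsub>V\<^esub> T u) z"
      using B_app[OF cu z] B_app[OF that(2) z] z that Tc
      by (simp add: V.ip_smult_left dual_space_def)
  qed (use that Tc submodule.smult_closed[OF Uhs, of c u] in auto)
  have injT: "inj_on T Uh"
    using injB T(2) by (auto simp: inj_on_def)
  define Q where "Q u = Re (iprod V (T u \<ominus>\<^bsub>V\<^esub> g) (T u \<ominus>\<^bsub>V\<^esub> g))" for u
  \<comment> \<open>\<open>l0\<close> vanishes on \<open>Vr\<close> and does not depend on
    \<open>u\<close>; the residual is the functional of \<open>T u \<ominus> g\<close> plus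
    \<open>l0\<close>.\<close>
  define l0 where "l0 v = iprod V g v - l v" for v
  have l0: "V.bounded_antilinear l0"
    by (rule V.bounded_antilinear_ip_diff[OF gc lb]) (simp add: l0_def)
  have diff: "T u \<ominus>\<^bsub>V\<^esub> g \<in> Vr" if "u \<in> Uh" for u
  proof -
    have "T u \<ominus>\<^bsub>V\<^esub> g = T u \<oplus>\<^bsub>V\<^esub> (-1) \<odot>\<^bsub>V\<^esub> g"
      by (rule V.ip_left_cancel) (use that Tc gc V.F_closed in \<open>auto simp: V.ip_simps\<close>)
    then show ?thesis
      using submodule.m_closed[OF V.is_module[OF Vr(1)]]
        submodule.smult_closed[OF V.is_module[OF Vr(1)], of "-1" g] that T(1) g(1) V.F_closed by auto
  qed
  have res: "(B u \<ominus>\<^bsub>dual_space F V\<^esub> l) v = iprod V (T u \<ominus>\<^bsub>V\<^esub> g) v + l0 v"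
    if "u \<in> Uh" "v \<in> carrier V" for u v
    using dual_space_minus_apply[OF F V.inner_product_record_axioms l that(2)] B_app that Tc gc
    by (simp add: l0_def V.ip_minus_left)
  have Jr: "Jr u = Q u" if "u \<in> Uh" for u
  proof -
    have "discrete_riesz_inv V Vr (B u \<ominus>\<^bsub>dual_space F V\<^esub> l) = T u \<ominus>\<^bsub>V\<^esub> g"
      using res that diff g Vrc by (intro discrete_riesz_inv_eq) (auto simp: l0_def)
    then show ?thesis using that Tc gc by (simp add: Jr_def Q_def V.ip_norm_sq)
  qed
  have J: "J u = Q u + (dual_norm V l0)\<^sup>2" if "u \<in> Uh" for u
  proof -
    have c: "T u \<ominus>\<^bsub>V\<^esub> g \<in> carrier V" using that Tc gc by simp
    \<comment> \<open>The Pythagorean identity is stated for a difference while the residual is a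
      sum, so it is applied to the negative of \<open>l0\<close>.\<close>
    have m: "dual_norm V (\<lambda>v. - l0 v) = dual_norm V l0" by (simp add: dual_norm_def)
    have "V.bounded_antilinear (\<lambda>v. - l0 v)"
      using l0 V.F_closed(7) by (auto simp: V.bounded_antilinear_def antilinear_def Pi_iff)
    moreover have "- l0 (T u \<ominus>\<^bsub>V\<^esub> g) = 0" using g diff that by (simp add: l0_def)
    ultimately have "(dual_norm V (B u \<ominus>\<^bsub>dual_space F V\<^esub> l))\<^sup>2 =
        (ip_norm V (T u \<ominus>\<^bsub>V\<^esub> g))\<^sup>2 + (dual_norm V (\<lambda>v. - l0 v))\<^sup>2"
      using res that by (intro V.dual_norm_pythagoras[OF c]) auto
    then show ?thesis using c by (simp add: J_def Q_def m V.ip_norm_sq)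
  qed
  \<comment> \<open>On \<open>Uh\<close> both objectives agree with \<open>Q\<close> up to a
    constant, so the \<open>is_arg_min\<close> predicates are equal and \<open>arg_min\<close>,
    which chooses from them, is the same.\<close>
  have "is_arg_min J (\<lambda>u. u \<in> Uh) = is_arg_min Q (\<lambda>u. u \<in> Uh)"
    "is_arg_min Jr (\<lambda>u. u \<in> Uh) = is_arg_min Q (\<lambda>u. u \<in> Uh)"
    using J Jr by (auto simp: is_arg_min_def fun_eq_iff)
  moreover have "\<exists>!u. is_arg_min Q (\<lambda>u. u \<in> Uh) u"
    unfolding Q_def[abs_def]
    by (rule V.least_squares_unique_minimizer[OF U Uh]) (use Tc injT T_add T_smult gc in auto)
  ultimately show "\<exists>!u. is_arg_min J (\<lambda>u. u \<in> Uh) u" "\<exists>!u. is_arg_min Jr (\<lambda>u. u \<in> Uh) u"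
    "arg_min J (\<lambda>u. u \<in> Uh) = arg_min Jr (\<lambda>u. u \<in> Uh)"
    by (simp_all add: arg_min_def)
qed

lemma stiffness_matrix_eq:
  assumes L: "L \<in> carrier U \<rightarrow> carrier V" and BL: "\<And>u. u \<in> carrier U \<Longrightarrow> B u = riesz V (L u)"
    and us: "is_basis F Uh U us" and bs: "is_basis F Vr V bs"
  defines "A \<equiv> mat (length us) (length us) (\<lambda>(i, j). iprod V (L (us ! j)) (L (us ! i)))"
    and "Bm \<equiv> mat (length bs) (length us) (\<lambda>(i, j). B (us ! j) (bs ! i))"
    and "G \<equiv> mat (length bs) (length bs) (\<lambda>(i, j). iprod V (bs ! j) (bs ! i))"
  shows "\<exists>Ginv. mat_inverse G = Some Ginv \<and> A = mat_adjoint Bm * Ginv * Bm"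
proof -
  have Vr: "subspace (scalars F) Vr V" and Uh: "subspace (scalars F) Uh U"
    and U: "vectorspace (scalars F) U"
    using setting by (auto simp: discrete_ls_setting_def fin_dim_subspace_def hilbert_space_def)
  have Vrc: "Vr \<subseteq> carrier V" using submodule.subset[OF V.is_module[OF Vr]] .
  have Uhc: "Uh \<subseteq> carrier U" using submodule.subset[OF vectorspace.is_module[OF U Uh]] .
  interpret W: inner_product_space F "V\<lparr>carrier := Vr\<rparr>" "iprod V"
    by (rule V.subspace_inner_product_space[OF Vr])
  have b: "distinct bs" "W.basis (set bs)" using bs by (simp_all add: is_basis_def)
  have bsc: "bs ! i \<in> Vr" if "i < length bs" for i
    using b(2) that nth_mem[OF that] by (auto simp: W.basis_def)
  have usc: "us ! j \<in> Uh" if "j < length us" for j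
  proof -
    have "set us \<subseteq> Uh"
      using us vectorspace.basis_def[OF vectorspace.subspace_is_vs[OF U Uh]] by (simp add: is_basis_def)
    then show ?thesis using nth_mem[OF that] by auto
  qed
  obtain T where T: "T \<in> Uh \<rightarrow> Vr" "\<And>u. u \<in> Uh \<Longrightarrow> B u = riesz V (T u)"
    using trial_riesz_representatives by blast
  \<comment> \<open>\<open>L u\<close> and \<open>T u\<close> have the same Riesz image, so
    injectivity places \<open>L u\<close> in \<open>Vr\<close>, where it has coordinates in
    \<open>bs\<close>.\<close>
  have Lc: "L u \<in> Vr" if "u \<in> Uh" for u
  proof -
    have "riesz V (L u) = riesz V (T u)" using T(2)[OF that] BL[of u] that Uhc by auto
    then have "L u = T u" using inj_onD[OF riesz_inj] L T(1) that Uhc Vrc by blast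
    then show ?thesis using T(1) that by auto
  qed
  have G: "W.gram_matrix bs = G" by (simp add: W.gram_matrix_def G_def)
  obtain Ginv where Ginv: "mat_inverse G = Some Ginv"
    using W.gram_matrix_invertible[OF b] unfolding G .
  \<comment> \<open>The shape required by the Gram matrix identity, with
    \<open>x j = L (us ! j)\<close>.\<close>
  have "Bm = mat (length bs) (length us) (\<lambda>(i, j). iprod V (L (us ! j)) (bs ! i))"
    unfolding Bm_def using BL usc bsc Uhc Vrc by (intro eq_matI) (auto simp: riesz_def subset_iff)
  then have "mat_adjoint Bm * Ginv * Bm = A"
    unfolding A_def using usc Lc Ginv
    by (intro W.adjoint_gram_inverse_mult[OF b]) (auto simp: G)
  then show ?thesis using Ginv by auto
qed

end

theorem mainTheorem1:
  fixes F :: "complex set"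
    and U :: "'u ip_space"
    and Uh :: "'u set"
  shows
    "(\<forall>(V :: 'v ip_space) B l Vr.
        discrete_ls_setting F U V B Uh Vr \<and> l \<in> carrier (dual_space F V) \<longrightarrow>
        (let J = (\<lambda>u. (dual_norm V (B u \<ominus>\<^bsub>dual_space F V\<^esub> l))\<^sup>2);
             Jr = (\<lambda>u. (ip_norm V (discrete_riesz_inv V Vr (B u \<ominus>\<^bsub>dual_space F V\<^esub> l)))\<^sup>2)
         in (\<exists>!u. is_arg_min J (\<lambda>u. u \<in> Uh) u) \<and>
            (\<exists>!u. is_arg_min Jr (\<lambda>u. u \<in> Uh) u) \<and>
            arg_min J (\<lambda>u. u \<in> Uh) = arg_min Jr (\<lambda>u. u \<in> Uh)))
     \<and>
     (\<forall>(\<Omega> :: (real ^ 'd) set) V B L Vr us vs.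
        bounded_lipschitz_domain \<Omega> \<and> V = L2_domain F \<Omega> \<and>
        discrete_ls_setting F U V B Uh Vr \<and>
        bounded_linear_op F U V (ip_norm V) L \<and>
        (\<forall>u\<in>carrier U. B u = riesz V (L u)) \<and>
        is_basis F Uh U us \<and> is_basis F Vr V vs \<longrightarrow>
        (let N = length us; M = length vs;
             A_LS = mat N N (\<lambda>(i, j). iprod V (L (us ! j)) (L (us ! i)));
             Bm = mat M N (\<lambda>(i, j). B (us ! j) (vs ! i));
             G = mat M M (\<lambda>(i, j). iprod V (vs ! j) (vs ! i))
         in \<exists>Ginv. mat_inverse G = Some Ginv \<and> A_LS = mat_adjoint Bm * Ginv * Bm))"
proof (intro conjI allI impI)
  fix V :: "'v ip_space" and B l Vr
  assume "discrete_ls_setting F U V B Uh Vr \<and> l \<in> carrier (dual_space F V)"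
  then show "let J = (\<lambda>u. (dual_norm V (B u \<ominus>\<^bsub>dual_space F V\<^esub> l))\<^sup>2);
             Jr = (\<lambda>u. (ip_norm V (discrete_riesz_inv V Vr (B u \<ominus>\<^bsub>dual_space F V\<^esub> l)))\<^sup>2)
         in (\<exists>!u. is_arg_min J (\<lambda>u. u \<in> Uh) u) \<and>
            (\<exists>!u. is_arg_min Jr (\<lambda>u. u \<in> Uh) u) \<and>
            arg_min J (\<lambda>u. u \<in> Uh) = arg_min Jr (\<lambda>u. u \<in> Uh)"
    unfolding Let_def by (elim conjE) (intro conjI minimizers_coincide)
next
  fix \<Omega> :: "(real ^ 'd) set" and V B L Vr us vs
  assume a: "bounded_lipschitz_domain \<Omega> \<and> V = L2_domain F \<Omega> \<and>
        discrete_ls_setting F U V B Uh Vr \<and>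
        bounded_linear_op F U V (ip_norm V) L \<and>
        (\<forall>u\<in>carrier U. B u = riesz V (L u)) \<and>
        is_basis F Uh U us \<and> is_basis F Vr V vs"
  then have "discrete_ls_setting F U V B Uh Vr" "L \<in> carrier U \<rightarrow> carrier V"
    by (auto simp: bounded_linear_op_def module_hom_def)
  then show "let N = length us; M = length vs;
             A_LS = mat N N (\<lambda>(i, j). iprod V (L (us ! j)) (L (us ! i)));
             Bm = mat M N (\<lambda>(i, j). B (us ! j) (vs ! i));
             G = mat M M (\<lambda>(i, j). iprod V (vs ! j) (vs ! i))
         in \<exists>Ginv. mat_inverse G = Some Ginv \<and> A_LS = mat_adjoint Bm * Ginv * Bm"
    unfolding Let_def using a by (intro stiffness_matrix_eq) auto
qed

end
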